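(* Let $j\in\{1,2,3\}$. For every $d>d_j$ there exists a uniformly distributed uniqueness set $\mathcal{U}_j\subseteq\mathbb{R}^2$ for the Gabor phase retrieval problem in $X_j$ having uniform density $D(\mathcal{U}_j)=d$, where 1. $d_1=12$ and $X_1=L^2(\mathbb{R})$, 2. $d_2=6$ and $X_2=L^2(\mathbb{R},\mathbb{R})$, 3. $d_3=3$ and $X_3=L^2_e(\mathbb{R},\mathbb{R})$. For $X_3=L^2_e(\mathbb{R},\mathbb{R})$, the uniqueness set $\mathcal{U}_3$ can be chosen to be separated.
   Context: $\mathbb{R}^2$ is identified with $\mathbb{C}$. $B_r(z)$ is the closed ball of radius $r$ around $z$ and $|B_r(z)|$ its Lebesgue measure. A set $\mathcal{U}$ is uniformly distributed if there is a non-negative real number $D(\mathcal{U})$, called its uniform density, with $\#(\mathcal{U}\cap B_r(z))=D(\mathcal{U})|B_r(z)|+o(r^2)$ as $r\to\infty$, uniformly with respect to $z$. A set $\mathcal{U}$ is separated if $\inf\{|u-u'|:u,u'\in\mathcal{U},\,u\ne u'\}>0$. $L^2(\mathbb{R})$ denotes the complex-valued square-integrable functions on $\mathbb{R}$, $L^2(\mathbb{R},\mathbb{R})$ its subset of real-valued functions, and $L^2_e(\mathbb{R},\mathbb{R})$ the even functions in $L^2(\mathbb{R},\mathbb{R})$. The Gabor transform of $g\in L^2(\mathbb{R})$ is $\mathcal{G}g(x,\omega)=\int_{\mathbb{R}}g(t)e^{-\pi(t-x)^2}e^{-2\pi i\omega t}\,dt$, $(x,\omega)\in\mathbb{R}^2$.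 A set $\mathcal{U}\subseteq\mathbb{R}^2$ is a uniqueness set for the Gabor phase retrieval problem in $X\subseteq L^2(\mathbb{R})$ if for all $g,h\in X$: whenever $|\mathcal{G}g(u)|=|\mathcal{G}h(u)|$ for all $u\in\mathcal{U}$, there is $\tau\in\mathbb{C}$ with $|\tau|=1$ and $g=\tau h$. *)

theory Defs
  imports "HOL-Analysis.Analysis"
begin

text \<open>
  The plane is identified with the type \<^typ>\<open>complex\<close>: a point \<open>(x, \<omega>)\<close> is \<open>Complex x \<omega>\<close>.

  The finiteness clause is needed because \<^const>\<open>card\<close> is 0 on infinite sets. The uniform limit
  says that the error term is \<open>o(r\<^sup>2)\<close> as \<open>r \<rightarrow> \<infinity>\<close>, uniformly in the centre \<open>z\<close>.
\<close>

definition has_uniform_density :: "complex set \<Rightarrow> real \<Rightarrow> bool" where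
  "has_uniform_density U D \<longleftrightarrow>
     D \<ge> 0 \<and>
     (\<forall>z r. finite (U \<inter> cball z r)) \<and>
     uniform_limit UNIV
       (\<lambda>r z. (real (card (U \<inter> cball z r)) - D * measure lebesgue (cball z r)) / r\<^sup>2)
       (\<lambda>z. 0) at_top"

definition uniformly_distributed :: "complex set \<Rightarrow> bool" where
  "uniformly_distributed U \<longleftrightarrow> (\<exists>D. has_uniform_density U D)"

definition uniform_density :: "complex set \<Rightarrow> real" where
  "uniform_density U = (THE D. has_uniform_density U D)"

lemma has_uniform_density_unique:
  assumes "has_uniform_density U D" "has_uniform_density U D'"
  shows "D = D'"
proof -
  let ?f = "\<lambda>D r. (real (card (U \<inter> cball 0 r)) - D * measure lebesgue (cball (0::complex) r)) / r\<^sup>2"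
  have "(?f D \<longlongrightarrow> 0) at_top" "(?f D' \<longlongrightarrow> 0) at_top"
    using assms tendsto_uniform_limitI[where x = "0::complex" and S = UNIV]
    unfolding has_uniform_density_def by fastforce+
  then have "((\<lambda>r. ?f D' r - ?f D r) \<longlongrightarrow> 0) at_top"
    using tendsto_diff by fastforce
  moreover have "\<forall>\<^sub>F r in at_top. ?f D' r - ?f D r = (D - D') * pi"
    using eventually_gt_at_top[of 0]
  proof eventually_elim
    case (elim r)
    have "measure lebesgue (cball (0::complex) r) = pi * r\<^sup>2"
      using elim by (simp add: content_cball unit_ball_vol_2)
    with elim show ?case by (simp add: field_simps)
  qed
  ultimately have "((\<lambda>r::real. (D - D') * pi) \<longlongrightarrow> 0) at_top"
    by (rule Lim_transform_eventually)
  then show ?thesis by (simp add: tendsto_const_iff)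
qed

lemma uniform_density_eq: "has_uniform_density U D \<Longrightarrow> uniform_density U = D"
  unfolding uniform_density_def using has_uniform_density_unique by blast

text \<open>
  The infimum is taken in the extended reals, so that sets with at most one point
  (infimum \<open>\<infinity>\<close>) are separated.
\<close>

definition separated_set :: "complex set \<Rightarrow> bool" where
  "separated_set U \<longleftrightarrow> 0 < (INF (u, v) \<in> {(u, v). u \<in> U \<and> v \<in> U \<and> u \<noteq> v}. ereal (cmod (u - v)))"

text \<open>
  Elements of \<open>L\<^sup>2\<close> are represented by functions; equality, real-valuedness and evenness are
  those of the classes modulo null sets and hence are required almost everywhere.
\<close>

definition L2_complex :: "(real \<Rightarrow> complex) set" where
  "L2_complex = {g \<in> borel_measurable lebesgue. integrable lebesgue (\<lambda>t. (cmod (g t))\<^sup>2)}"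

definition L2_real :: "(real \<Rightarrow> complex) set" where
  "L2_real = {g \<in> L2_complex. AE t in lebesgue. g t \<in> \<real>}"

definition L2_real_even :: "(real \<Rightarrow> complex) set" where
  "L2_real_even = {g \<in> L2_real. AE t in lebesgue. g (- t) = g t}"

definition gabor :: "(real \<Rightarrow> complex) \<Rightarrow> real \<Rightarrow> real \<Rightarrow> complex" where
  "gabor g x \<omega> =
     (LINT t|lebesgue. g t * of_real (exp (- pi * (t - x)\<^sup>2)) * exp (- 2 * of_real pi * \<i> * of_real \<omega> * of_real t))"

definition gabor_uniqueness_set :: "complex set \<Rightarrow> (real \<Rightarrow> complex) set \<Rightarrow> bool" where
  "gabor_uniqueness_set U X \<longleftrightarrow>
     (\<forall>g\<in>X. \<forall>h\<in>X.
        (\<forall>u\<in>U. cmod (gabor g (Re u) (Im u)) = cmod (gabor h (Re u) (Im u))) \<longrightarrow>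
        (\<exists>\<tau>. cmod \<tau> = 1 \<and> (AE t in lebesgue. g t = \<tau> * h t)))"

end

theory Submission
  imports Defs "HOL-Complex_Analysis.Complex_Analysis" "HOL-Probability.Probability" "HOL-Real_Asymp.Real_Asymp"
begin

text \<open>
  With \<open>u = x + \<i>\<omega>\<close>, the modulus of the Gabor transform of \<open>g\<close> at \<open>u\<close> is
  \<open>\<bar>F (cnj u)\<bar> exp (- \<pi> \<bar>u\<bar>\<^sup>2 / 2)\<close>, where \<open>F\<close> is the Bargmann transform of \<open>g\<close>: an entire function
  with \<open>\<bar>F z\<bar> \<le> C exp (\<pi> \<bar>z\<bar>\<^sup>2 / 2)\<close> that determines \<open>g\<close> (\<open>cmod_gabor_eq_bargmann\<close>,
  \<open>bargmann_growth\<close>, \<open>bargmann_injective\<close>). So two entire functions \<open>F\<close> and \<open>H\<close> of this growth have to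
  be shown to agree up to a unimodular factor once \<open>\<bar>F\<bar> = \<bar>H\<bar>\<close> on a suitable set.

  The set consists of triples of noncollinear points that cluster extremely closely around the points
  \<open>\<lambda>\<close> of a lattice. Equality of the moduli at such a triple says that \<open>\<bar>F\<bar> = \<bar>H\<bar>\<close> at \<open>\<lambda>\<close> and, by Taylor
  expansion, that the gradients of \<open>\<bar>F\<bar>\<^sup>2\<close> and \<open>\<bar>H\<bar>\<^sup>2\<close> almost agree there. The gradient of \<open>\<bar>F\<bar>\<^sup>2\<close> is
  encoded by \<open>F' cnj F\<close>, and \<open>\<bar>F\<bar>\<^sup>2 (F' H - F H') = F H (F' cnj F - H' cnj H)\<close> where \<open>\<bar>F\<bar> = \<bar>H\<bar>\<close>. Hence the
  entire function \<open>F\<^sup>2 (F' H - F H')\<close> decays along the lattice (\<open>wronskian_bound_of_equal_moduli\<close>). It is a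
  sum of products of four factors, so that its growth is hardly more than \<open>exp (2 \<pi> \<bar>z\<bar>\<^sup>2)\<close>.

  An entire function of growth \<open>exp (\<kappa> \<bar>z\<bar>\<^sup>2)\<close> that is bounded on a separated set of density
  \<open>\<rho> > 2 \<kappa> / \<pi>\<close> is constant (\<open>bounded_on_dense_set_imp_constant\<close>). For \<open>\<kappa>\<close> slightly above \<open>2 \<pi>\<close> this needs
  a lattice of density slightly above \<open>4\<close>; then the function above is constant, it decays on the lattice, so
  it vanishes, and either \<open>F = 0\<close> or \<open>H / F\<close> is constant. Three points per lattice point give
  the density \<open>12\<close>.

  For real \<open>g\<close> the modulus of the Gabor transform is invariant under \<open>u \<mapsto> cnj u\<close>, and for even real \<open>g\<close> also
  under \<open>u \<mapsto> - u\<close>. The lattice \<open>\<alpha> (\<int> + 1/2) + \<i> \<alpha> (\<int> + 1/2)\<close> has both symmetries. Reflections reverse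
  the parity of the row or column index, so an orbit under conjugation has exactly one point in an even row, and an
  orbit under both reflections exactly one point in an even row and an even column. Sublattices of index two
  and four therefore carry all the information, and the densities drop to \<open>6\<close> and \<open>3\<close>. In the even case
  the three points of a triple can be moved to three different points of the orbit, which makes the set separated.
\<close>

section \<open>Entire functions with many small values\<close>

text \<open>
  The zeros are divided out one at a time by Blaschke factors of the disc, which have modulus one on the
  circle, and the maximum principle bounds what remains at the centre. This is Jensen's inequality
  in a form that stays meaningful when \<open>f 0 = 0\<close>.
\<close>

lemma entire_zeros_product_bound:
  fixes f :: "complex \<Rightarrow> complex"
  assumes "f holomorphic_on UNIV" and "R > 0"
    and "\<And>z. cmod z = R \<Longrightarrow> cmod (f z) \<le> M"
    and "finite S" and "S \<subseteq> ball 0 R" and "\<And>a. a \<in> S \<Longrightarrow> f a = 0"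
  shows "cmod (f 0) \<le> M * (\<Prod>a\<in>S. cmod a / R)"
  using assms(4) assms(1,3,5,6)
proof (induction S arbitrary: f rule: finite_induct)
  case empty
  have "cmod (f 0) \<le> M"
  proof (rule maximum_modulus_frontier[of f "cball 0 R"])
    show "f holomorphic_on interior (cball 0 R)"
      using empty(1) holomorphic_on_subset by blast
    show "continuous_on (closure (cball 0 R)) f"
      using empty(1) holomorphic_on_imp_continuous_on holomorphic_on_subset by blast
    show "cmod (f z) \<le> M" if "z \<in> frontier (cball 0 R)" for z
      using that empty(2) \<open>R > 0\<close> by (auto simp: dist_norm)
  qed (use \<open>R > 0\<close> in auto)
  then show ?case by simp
next
  case (insert a S)
  define q where "q = (\<lambda>z. if z = a then deriv f a else (f z - f a) / (z - a))"
  have fa: "f a = 0" using insert.prems by auto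
  have q: "q holomorphic_on UNIV"
    unfolding q_def using insert.prems(1) by (rule pole_lemma_open) auto
  have fq: "f z = (z - a) * q z" for z
    using fa by (auto simp: q_def)
  \<comment> \<open>dividing \<open>f\<close> by the Blaschke factor at \<open>a\<close> keeps its modulus on the circle\<close>
  define g where "g = (\<lambda>z. q z * ((of_real (R\<^sup>2) - cnj a * z) / of_real R))"
  have g: "g holomorphic_on UNIV"
    unfolding g_def using q by (intro holomorphic_intros) (use \<open>R > 0\<close> in auto)
  have gM: "cmod (g z) \<le> M" if z: "cmod z = R" for z
  proof -
    have "of_real (R\<^sup>2) - cnj a * z = z * cnj (z - a)"
      using z by (simp add: algebra_simps flip: complex_norm_square)
    then have "cmod (of_real (R\<^sup>2) - cnj a * z) = R * cmod (z - a)"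
      using z by (simp only: norm_mult complex_mod_cnj)
    then have "cmod (g z) = cmod (q z) * cmod (z - a)"
      using \<open>R > 0\<close> by (simp add: g_def norm_mult norm_divide)
    also have "\<dots> = cmod (f z)" by (simp add: fq norm_mult)
    finally show ?thesis using insert.prems(2)[OF z] by simp
  qed
  have g0: "g b = 0" if "b \<in> S" for b
  proof -
    have "b \<noteq> a" "f b = 0" using that insert.hyps insert.prems by auto
    then show ?thesis using fq[of b] by (simp add: g_def)
  qed
  have "cmod (g 0) \<le> M * (\<Prod>a\<in>S. cmod a / R)"
    by (rule insert.IH) (use g gM g0 insert.prems in auto)
  then have "cmod a / R * cmod (g 0) \<le> cmod a / R * (M * (\<Prod>a\<in>S. cmod a / R))"
    using \<open>R > 0\<close> by (intro mult_left_mono) auto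
  moreover have "cmod (f 0) = cmod a / R * cmod (g 0)"
    using \<open>R > 0\<close> by (simp add: fq[of 0] g_def norm_mult norm_divide power2_eq_square)
  ultimately show ?case
    using insert.hyps by (simp add: algebra_simps)
qed

text \<open>
  The interpolating polynomial is crudely estimated: its size depends only on the radius, the separation
  and the number of nodes, which is all that is needed to replace small values by zeros.
\<close>

lemma lagrange_interpolation_bound:
  fixes f :: "complex \<Rightarrow> complex"
  assumes "finite S" and S: "S \<subseteq> cball 0 R" and "s > 0"
    and sep: "\<And>a b. a \<in> S \<Longrightarrow> b \<in> S \<Longrightarrow> a \<noteq> b \<Longrightarrow> s \<le> cmod (a - b)"
    and small: "\<And>a. a \<in> S \<Longrightarrow> cmod (f a) \<le> e" and "e \<ge> 0" and N: "card S \<le> N"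
  obtains P where "P holomorphic_on UNIV" "\<And>a. a \<in> S \<Longrightarrow> P a = f a"
    "\<And>z. cmod z \<le> R \<Longrightarrow> cmod (P z) \<le> N * max 1 (2 * R / s) ^ N * e"
proof
  define P where "P = (\<lambda>z. \<Sum>a\<in>S. f a * (\<Prod>b\<in>S - {a}. (z - b) / (a - b)))"
  show "P holomorphic_on UNIV"
    unfolding P_def by (intro holomorphic_intros) auto
  show "P a = f a" if a: "a \<in> S" for a
  proof -
    have "(\<Prod>b\<in>S - {c}. (a - b) / (c - b)) = (if c = a then 1 else 0)" if "c \<in> S" for c
    proof (cases "c = a")
      case False
      then have "(\<Prod>b\<in>S - {c}. (a - b) / (c - b)) = 0"
        using a \<open>finite S\<close> by (intro prod_zero) auto
      then show ?thesis using False by simp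
    qed (auto intro!: prod.neutral split: if_splits)
    then have "P a = (\<Sum>c\<in>S. if c = a then f a else 0)"
      unfolding P_def by (intro sum.cong) auto
    then show ?thesis using a \<open>finite S\<close> by simp
  qed
  show "cmod (P z) \<le> N * max 1 (2 * R / s) ^ N * e" if z: "cmod z \<le> R" for z
  proof -
    let ?q = "max 1 (2 * R / s)"
    have *: "cmod (f a * (\<Prod>b\<in>S - {a}. (z - b) / (a - b))) \<le> e * ?q ^ N" if a: "a \<in> S" for a
    proof -
      have "(\<Prod>b\<in>S - {a}. cmod ((z - b) / (a - b))) \<le> (\<Prod>b\<in>S - {a}. ?q)"
      proof (intro prod_mono conjI)
        fix b assume b: "b \<in> S - {a}"
        have "cmod (z - b) \<le> 2 * R"
          using norm_triangle_ineq4[of z b] z b S by auto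
        moreover have "s \<le> cmod (a - b)" using sep a b by auto
        ultimately have "cmod (z - b) / cmod (a - b) \<le> 2 * R / s"
          using \<open>s > 0\<close> order_trans[OF norm_ge_zero z] by (intro frac_le) auto
        then show "cmod ((z - b) / (a - b)) \<le> ?q" by (simp add: norm_divide)
      qed auto
      also have "\<dots> = ?q ^ card (S - {a})" by simp
      also have "\<dots> \<le> ?q ^ N"
        using N card_Diff1_le[of S a] by (intro power_increasing) auto
      finally show ?thesis
        unfolding norm_mult prod_norm[symmetric]
        using small[OF a] \<open>e \<ge> 0\<close> by (intro mult_mono) (auto intro!: prod_nonneg)
    qed
    have "cmod (P z) \<le> (\<Sum>a\<in>S. e * ?q ^ N)"
      unfolding P_def by (rule order_trans[OF norm_sum sum_mono]) (rule *)
    also have "\<dots> = card S * (?q ^ N * e)" by simp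
    also have "\<dots> \<le> N * (?q ^ N * e)"
      using N \<open>e \<ge> 0\<close> by (intro mult_right_mono) auto
    finally show ?thesis by (simp add: mult.assoc)
  qed
qed

text \<open>
  A function that is not small at the centre cannot be small at all points of \<open>S\<close> if these are so many
  that the Blaschke product is tiny: subtracting the interpolating polynomial would turn them into zeros.
  The threshold \<open>e\<close> depends on \<open>R\<close>, \<open>s\<close> and \<open>N\<close> only, hence it is uniform over all functions and all
  translates of \<open>S\<close>.
\<close>

lemma not_all_values_small:
  fixes f :: "complex \<Rightarrow> complex"
  assumes f: "f holomorphic_on UNIV" and "R > 0"
    and M: "\<And>z. cmod z = R \<Longrightarrow> cmod (f z) \<le> M" and f0: "cmod (f 0) \<ge> 1 / 2"
    and S: "finite S" "S \<subseteq> ball 0 R" "card S \<le> N" and "s > 0"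
    and sep: "\<And>a b. a \<in> S \<Longrightarrow> b \<in> S \<Longrightarrow> a \<noteq> b \<Longrightarrow> s \<le> cmod (a - b)"
    and prod: "M * (\<Prod>a\<in>S. cmod a / R) \<le> 1 / 8"
    and e: "e \<ge> 0" "N * max 1 (2 * R / s) ^ N * e \<le> 1 / 8"
  shows "\<exists>a\<in>S. cmod (f a) > e"
proof (rule ccontr)
  assume "\<not> ?thesis"
  then have small: "cmod (f a) \<le> e" if "a \<in> S" for a using that by force
  obtain P where P: "P holomorphic_on UNIV" "\<And>a. a \<in> S \<Longrightarrow> P a = f a"
    "\<And>z. cmod z \<le> R \<Longrightarrow> cmod (P z) \<le> N * max 1 (2 * R / s) ^ N * e"
    using lagrange_interpolation_bound[of S R s f e N] S sep small e \<open>s > 0\<close>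
    by (metis ball_subset_cball subset_trans)
  have P8: "cmod (P z) \<le> 1 / 8" if "cmod z \<le> R" for z using P(3)[OF that] e(2) by linarith
  have "cmod (f 0 - P 0) \<le> (M + 1 / 8) * (\<Prod>a\<in>S. cmod a / R)"
  proof (rule entire_zeros_product_bound)
    show "(\<lambda>z. f z - P z) holomorphic_on UNIV" using f P(1) by (intro holomorphic_intros)
    show "cmod (f z - P z) \<le> M + 1 / 8" if "cmod z = R" for z
      using norm_triangle_ineq4[of "f z" "P z"] M[OF that] P8[of z] that by linarith
  qed (use S P(2) \<open>R > 0\<close> in auto)
  also have "(\<Prod>a\<in>S. cmod a / R) \<le> 1"
    using S(2) \<open>R > 0\<close> by (intro prod_le_1) (auto simp: subset_iff)
  then have "(M + 1 / 8) * (\<Prod>a\<in>S. cmod a / R) \<le> 1 / 8 + 1 / 8"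
    using prod by (simp add: algebra_simps)
  finally have "cmod (f 0 - P 0) \<le> 1 / 4" by simp
  moreover have "cmod (P 0) \<le> 1 / 8" using P8[of 0] \<open>R > 0\<close> by simp
  ultimately show False
    using f0 norm_triangle_ineq2[of "f 0" "P 0"] by linarith
qed

text \<open>
  The logarithm of \<open>R / \<bar>a\<bar>\<close> is at least \<open>h\<close> times the number of radii \<open>R exp (- h k)\<close> that are not smaller
  than \<open>\<bar>a\<bar>\<close>. Summing over \<open>a\<close> turns the product into counts of points in concentric discs, a discrete
  version of the integral of \<open>n(t) / t\<close> in Jensen's formula.
\<close>

lemma modulus_product_bound_layered:
  fixes S :: "complex set"
  assumes "finite S" "S \<subseteq> ball 0 R" "R > 0" "h > 0"
  shows "(\<Prod>a\<in>S. cmod a / R)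
           \<le> exp (- h * (\<Sum>k=1..K. real (card (S \<inter> cball 0 (R * exp (- h * real k))))))"
proof -
  define T where "T = (\<lambda>a::complex. {k\<in>{1..K}. cmod a \<le> R * exp (- h * real k)})"
  have *: "cmod a / R \<le> exp (- h * real (card (T a)))" if a: "a \<in> S" for a
  proof (cases "T a = {}")
    case True
    then show ?thesis using a assms by (auto simp: subset_iff)
  next
    case False
    have fin: "finite (T a)" by (simp add: T_def)
    have "T a \<subseteq> {1..Max (T a)}" using fin by (auto simp: T_def)
    then have "card (T a) \<le> Max (T a)" using card_mono[of "{1..Max (T a)}" "T a"] by simp
    then have "exp (- h * real (Max (T a))) \<le> exp (- h * real (card (T a)))"
      using \<open>h > 0\<close> by simp
    moreover have "Max (T a) \<in> T a" using fin False by simp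
    then have "cmod a / R \<le> exp (- h * real (Max (T a)))"
      using \<open>R > 0\<close> by (simp add: T_def field_simps)
    ultimately show ?thesis by linarith
  qed
  have "(\<Prod>a\<in>S. cmod a / R) \<le> (\<Prod>a\<in>S. exp (- h * real (card (T a))))"
    using * \<open>R > 0\<close> by (intro prod_mono) auto
  also have "\<dots> = exp (- h * (\<Sum>a\<in>S. real (card (T a))))"
    using \<open>finite S\<close> by (simp add: exp_sum sum_distrib_left flip: sum_negf)
  also have "(\<Sum>a\<in>S. real (card (T a)))
      = (\<Sum>a\<in>S. \<Sum>k=1..K. of_bool (cmod a \<le> R * exp (- h * real k)))"
    by (simp add: T_def Int_def)
  also have "\<dots> = (\<Sum>k=1..K. \<Sum>a\<in>S. of_bool (cmod a \<le> R * exp (- h * real k)))"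
    by (rule sum.swap)
  also have "\<dots> = (\<Sum>k=1..K. real (card (S \<inter> cball 0 (R * exp (- h * real k)))))"
    using \<open>finite S\<close> by (simp add: Int_def)
  finally show ?thesis .
qed

section \<open>Boundedness on a set of uniform density\<close>

lemma has_uniform_densityD:
  assumes "has_uniform_density U D" and "e > 0"
  obtains r0 where "r0 > 0"
    "\<And>z r. r \<ge> r0 \<Longrightarrow> \<bar>real (card (U \<inter> cball z r)) - D * (pi * r\<^sup>2)\<bar> \<le> e * r\<^sup>2"
proof -
  have "\<forall>\<^sub>F r in at_top. \<forall>z. \<bar>(real (card (U \<inter> cball z r)) - D * measure lebesgue (cball z r)) / r\<^sup>2\<bar> < e"
    using assms unfolding has_uniform_density_def uniform_limit_iff by (simp add: dist_real_def)
  then obtain b where b: "\<And>r z. r \<ge> b \<Longrightarrow>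
      \<bar>(real (card (U \<inter> cball z r)) - D * measure lebesgue (cball z r)) / r\<^sup>2\<bar> < e"
    unfolding eventually_at_top_linorder by blast
  have "\<bar>real (card (U \<inter> cball z r)) - D * (pi * r\<^sup>2)\<bar> \<le> e * r\<^sup>2" if r: "r \<ge> max b 1" for z r
  proof -
    have "measure lebesgue (cball z r) = pi * r\<^sup>2"
      using r by (simp add: content_cball unit_ball_vol_2)
    then show ?thesis
      using b[of r z] r by (simp add: abs_divide pos_divide_less_eq)
  qed
  then show ?thesis using that[of "max b 1"] by auto
qed

text \<open>
  The Riemann sums of \<open>exp (- 2 x)\<close> over \<open>{0..}\<close> with step \<open>h\<close> approach \<open>1/2\<close>, so the layered estimate loses
  arbitrarily little against the integral when \<open>h\<close> is small and \<open>K\<close> is large.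
\<close>

lemma layer_weights:
  assumes "c < 1 / 2"
  obtains h :: real and K where "h > 0" "c < h * (\<Sum>k=1..K. exp (- 2 * h * real k))"
proof -
  have "((\<lambda>h::real. h / (exp (2 * h) - 1)) \<longlongrightarrow> 1 / 2) (at_right 0)"
    by real_asymp
  then have "\<forall>\<^sub>F h in at_right 0. c < h / (exp (2 * h) - 1) \<and> h > (0::real)"
    using assms by (intro eventually_conj order_tendstoD eventually_at_right_less) auto
  then obtain h where h: "h > 0" "c < h / (exp (2 * h) - 1)"
    by (metis (mono_tags, lifting) eventually_happens trivial_limit_at_right_real)
  let ?q = "exp (- 2 * h)"
  have q: "(\<lambda>k. ?q * ?q ^ k) sums (?q * (1 / (1 - ?q)))"
    using h by (intro sums_mult geometric_sums) auto
  have "?q * (1 / (1 - ?q)) = 1 / (exp (2 * h) - 1)"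
    using h by (simp add: exp_minus field_simps)
  moreover have "(\<Sum>k<n. ?q * ?q ^ k) = (\<Sum>k=1..n. exp (- 2 * h * real k))" for n
  proof -
    have "(\<Sum>k=1..n. exp (- 2 * h * real k)) = (\<Sum>k<n. exp (- 2 * h * real (Suc k)))"
      by (simp add: sum.atLeast1_atMost_eq)
    also have "\<dots> = (\<Sum>k<n. ?q * ?q ^ k)"
      by (intro sum.cong) (simp_all add: exp_add[symmetric] exp_of_nat_mult[symmetric] algebra_simps)
    finally show ?thesis by simp
  qed
  ultimately have "(\<lambda>n. \<Sum>k=1..n. exp (- 2 * h * real k)) \<longlonglongrightarrow> 1 / (exp (2 * h) - 1)"
    using q by (simp add: sums_def)
  then have "(\<lambda>n. h * (\<Sum>k=1..n. exp (- 2 * h * real k))) \<longlonglongrightarrow> h * (1 / (exp (2 * h) - 1))"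
    by (intro tendsto_mult tendsto_const)
  then have "\<forall>\<^sub>F n in sequentially. c < h * (\<Sum>k=1..n. exp (- 2 * h * real k))"
    using h by (intro order_tendstoD) auto
  then obtain K where "c < h * (\<Sum>k=1..K. exp (- 2 * h * real k))"
    by (metis (mono_tags, lifting) eventually_happens trivial_limit_sequentially)
  then show ?thesis using that h by blast
qed

text \<open>
  A disc of radius \<open>R\<close> contains about \<open>\<pi> \<rho> R\<^sup>2\<close> points, so the layers show that the Blaschke product
  is at most about \<open>exp (- \<pi> \<rho> R\<^sup>2 / 2)\<close>. This beats the growth \<open>exp (\<kappa> R\<^sup>2)\<close>, and the same \<open>R\<close> serves all
  centres because the density is uniform.
\<close>

lemma uniform_density_product_small:
  assumes dens: "has_uniform_density \<Lambda> \<rho>" and "\<kappa> \<ge> 0" and \<kappa>: "\<kappa> < pi * \<rho> / 2"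
  obtains R N where "R > 0" "\<And>v. card (\<Lambda> \<inter> cball v R) \<le> N"
    "\<And>v. exp (\<kappa> * R\<^sup>2) * (\<Prod>a\<in>(\<lambda>a. a - v) ` (\<Lambda> \<inter> ball v R). cmod a / R) \<le> 1 / 8"
proof -
  have "\<rho> > 0" using \<open>\<kappa> \<ge> 0\<close> \<kappa> pi_gt_zero by (smt (verit) divide_nonpos_pos mult_nonneg_nonpos)
  then have "\<kappa> / (pi * \<rho>) < 1 / 2" using \<kappa> by (simp add: field_simps)
  then obtain h K where h: "h > 0" "\<kappa> / (pi * \<rho>) < h * (\<Sum>k=1..K. exp (- 2 * h * real k))"
    using layer_weights by blast
  define A where "A = h * (\<Sum>k=1..K. exp (- 2 * h * real k))"
  have A: "A * (pi * \<rho>) > \<kappa>" using h(2) \<open>\<rho> > 0\<close> by (simp add: A_def field_simps)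
  have "A > 0" using A \<open>\<kappa> \<ge> 0\<close> \<open>\<rho> > 0\<close> by (smt (verit) mult_nonneg_nonneg mult_nonpos_nonneg pi_gt_zero)
  \<comment> \<open>half of the slack between \<open>A \<pi> \<rho>\<close> and \<open>\<kappa>\<close> is left for the error of the count\<close>
  define \<eta> where "\<eta> = (pi * \<rho> - \<kappa> / A) / 2"
  have "\<eta> > 0" using A \<open>A > 0\<close> by (simp add: \<eta>_def field_simps)
  define \<kappa>' where "\<kappa>' = A * (pi * \<rho> - \<eta>)"
  have \<kappa>': "\<kappa>' > \<kappa>" using A \<open>A > 0\<close> by (simp add: \<kappa>'_def \<eta>_def field_simps)
  obtain r0 where r0: "r0 > 0"
    "\<And>z r. r \<ge> r0 \<Longrightarrow> \<bar>real (card (\<Lambda> \<inter> cball z r)) - \<rho> * (pi * r\<^sup>2)\<bar> \<le> \<eta> * r\<^sup>2"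
    using has_uniform_densityD[OF dens \<open>\<eta> > 0\<close>] by blast
  have "filterlim (\<lambda>R. (\<kappa>' - \<kappa>) * R\<^sup>2) at_top at_top"
    using \<kappa>' by (intro filterlim_tendsto_pos_mult_at_top[OF tendsto_const] filterlim_pow_at_top filterlim_ident) auto
  then have "\<forall>\<^sub>F R in at_top. (\<kappa>' - \<kappa>) * R\<^sup>2 \<ge> ln 8"
    by (simp add: filterlim_at_top)
  then have "\<forall>\<^sub>F R in at_top. (\<kappa>' - \<kappa>) * R\<^sup>2 \<ge> ln 8 \<and> R \<ge> r0 * exp (h * real K)"
    by (intro eventually_conj eventually_ge_at_top)
  then obtain R where R: "(\<kappa>' - \<kappa>) * R\<^sup>2 \<ge> ln 8" "R \<ge> r0 * exp (h * real K)"
    by (metis (mono_tags, lifting) eventually_happens trivial_limit_at_top_linorder)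
  have Rr0: "R \<ge> r0" using R(2) r0(1) h(1)
    by (smt (verit, ccfv_threshold) mult_le_cancel_left1 mult_nonneg_nonneg of_nat_0_le_iff one_le_exp_iff)
  then have "R > 0" using r0 by simp
  have fin: "finite (\<Lambda> \<inter> cball v r)" for v r
    using dens by (auto simp: has_uniform_density_def)
  show ?thesis
  proof (rule that)
    show "R > 0" by fact
    show "card (\<Lambda> \<inter> cball v R) \<le> nat \<lceil>\<eta> * R\<^sup>2 + \<rho> * (pi * R\<^sup>2)\<rceil>" for v
      using r0(2)[OF Rr0, of v] by linarith
    show "exp (\<kappa> * R\<^sup>2) * (\<Prod>a\<in>(\<lambda>a. a - v) ` (\<Lambda> \<inter> ball v R). cmod a / R) \<le> 1 / 8" for v
    proof -
      let ?S = "(\<lambda>a. a - v) ` (\<Lambda> \<inter> ball v R)"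
      have layer: "card (?S \<inter> cball 0 r) = card (\<Lambda> \<inter> cball v r)" if "r < R" for r
      proof -
        have "?S \<inter> cball 0 r = (\<lambda>a. a - v) ` (\<Lambda> \<inter> cball v r)"
          using that by (auto simp: dist_norm norm_minus_commute)
        then show ?thesis by (simp add: card_image)
      qed
      have bound: "(pi * \<rho> - \<eta>) * (R\<^sup>2 * exp (- 2 * h * real k))
          \<le> real (card (?S \<inter> cball 0 (R * exp (- h * real k))))" if k: "k \<in> {1..K}" for k
      proof -
        let ?r = "R * exp (- h * real k)"
        have "?r < R" using k h \<open>R > 0\<close> by simp
        have "R * exp (- h * real K) \<le> ?r" using k h \<open>R > 0\<close> by simp
        moreover have "r0 \<le> R * exp (- h * real K)" using R(2) by (simp add: exp_minus field_simps)
        ultimately have "\<bar>real (card (\<Lambda> \<inter> cball v ?r)) - \<rho> * (pi * ?r\<^sup>2)\<bar> \<le> \<eta> * ?r\<^sup>2"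
          by (intro r0) simp
        then have "(pi * \<rho> - \<eta>) * ?r\<^sup>2 \<le> real (card (\<Lambda> \<inter> cball v ?r))"
          by (simp add: algebra_simps abs_le_iff)
        moreover have "?r\<^sup>2 = R\<^sup>2 * exp (- 2 * h * real k)"
          by (simp add: power_mult_distrib power2_eq_square exp_add[symmetric])
        ultimately show ?thesis
          unfolding layer[OF \<open>?r < R\<close>] by simp
      qed
      have fS: "finite ?S" by (meson ball_subset_cball fin finite_imageI finite_subset Int_mono order_refl)
      have "(\<Prod>a\<in>?S. cmod a / R)
          \<le> exp (- h * (\<Sum>k=1..K. real (card (?S \<inter> cball 0 (R * exp (- h * real k))))))"
        using fS \<open>R > 0\<close> h(1)
        by (intro modulus_product_bound_layered) (auto simp: dist_norm norm_minus_commute)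
      also have "\<dots> \<le> exp (- h * (\<Sum>k=1..K. (pi * \<rho> - \<eta>) * (R\<^sup>2 * exp (- 2 * h * real k))))"
      proof -
        have "(\<Sum>k=1..K. (pi * \<rho> - \<eta>) * (R\<^sup>2 * exp (- 2 * h * real k)))
            \<le> (\<Sum>k=1..K. real (card (?S \<inter> cball 0 (R * exp (- h * real k)))))"
          by (intro sum_mono bound)
        then show ?thesis using h(1) by (simp only: exp_le_cancel_iff mult_minus_left neg_le_iff_le mult_left_mono)
      qed
      also have "- h * (\<Sum>k=1..K. (pi * \<rho> - \<eta>) * (R\<^sup>2 * exp (- 2 * h * real k))) = - \<kappa>' * R\<^sup>2"
        unfolding \<kappa>'_def A_def by (simp flip: sum_distrib_left)
      finally have "exp (\<kappa> * R\<^sup>2) * (\<Prod>a\<in>?S. cmod a / R) \<le> exp (\<kappa> * R\<^sup>2) * exp (- \<kappa>' * R\<^sup>2)"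
        by (intro mult_left_mono) auto
      also have "\<dots> = exp (- ((\<kappa>' - \<kappa>) * R\<^sup>2))"
        by (simp add: exp_add[symmetric] algebra_simps)
      also have "\<dots> \<le> exp (- ln 8)" using R(1) by simp
      also have "\<dots> = 1 / 8" by (simp add: exp_minus)
      finally show ?thesis .
    qed
  qed
qed

text \<open>
  Moving the centre of a Gaussian weight costs a constant factor as soon as the exponent is increased;
  the constant comes from completing the square \<open>((\<kappa>' - \<kappa>) \<bar>z - w\<bar> - \<kappa> \<bar>w\<bar>)\<^sup>2\<close>.
\<close>

lemma gaussian_weight_shift:
  fixes z w :: complex
  assumes "0 \<le> \<kappa>" "\<kappa> < \<kappa>'"
  shows "exp (\<kappa> * (cmod z)\<^sup>2)
           \<le> exp ((\<kappa> + \<kappa>\<^sup>2 / (\<kappa>' - \<kappa>)) * (cmod w)\<^sup>2) * exp (\<kappa>' * (cmod (z - w))\<^sup>2)"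
proof -
  define a where "a = cmod (z - w)"
  define b where "b = cmod w"
  have "cmod z \<le> a + b" using norm_triangle_ineq[of "z - w" w] by (simp add: a_def b_def)
  then have "\<kappa> * (cmod z)\<^sup>2 \<le> \<kappa> * (a + b)\<^sup>2"
    using assms by (intro mult_left_mono power_mono) auto
  also have "\<dots> \<le> \<kappa> * (a + b)\<^sup>2 + ((\<kappa>' - \<kappa>) * a - \<kappa> * b)\<^sup>2 / (\<kappa>' - \<kappa>)"
    using assms by simp
  also have "\<dots> = (\<kappa> + \<kappa>\<^sup>2 / (\<kappa>' - \<kappa>)) * b\<^sup>2 + \<kappa>' * a\<^sup>2"
    using assms by (simp add: field_simps power2_eq_square)
  finally show ?thesis
    by (simp add: a_def b_def flip: exp_add)
qed

text \<open>
  Fix \<open>w\<close> and let \<open>M\<close> be the supremum of \<open>\<bar>f z\<bar> exp (- \<kappa>1 \<bar>z - w\<bar>\<^sup>2)\<close>. Recentring at a point where the supremum is nearly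
  attained, \<open>not_all_values_small\<close> produces a point of \<open>\<Lambda>\<close> near it at which the weighted function
  is at least a fixed multiple of \<open>M\<close>; since \<open>f\<close> is bounded on \<open>\<Lambda>\<close>, so is \<open>M\<close>. All constants are independent of the
  centre \<open>w\<close> of the weight, and \<open>\<bar>f w\<bar> \<le> M\<close>, so \<open>f\<close> is bounded on the whole plane.
\<close>

theorem bounded_on_dense_set_imp_constant:
  fixes f :: "complex \<Rightarrow> complex"
  assumes f: "f holomorphic_on UNIV"
    and growth: "\<And>z. cmod (f z) \<le> C * exp (\<kappa> * (cmod z)\<^sup>2)"
    and dens: "has_uniform_density \<Lambda> \<rho>" and \<kappa>: "0 \<le> \<kappa>" "\<kappa> < pi * \<rho> / 2"
    and "s > 0" and sep: "\<And>a b. a \<in> \<Lambda> \<Longrightarrow> b \<in> \<Lambda> \<Longrightarrow> a \<noteq> b \<Longrightarrow> s \<le> cmod (a - b)"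
    and B: "\<And>a. a \<in> \<Lambda> \<Longrightarrow> cmod (f a) \<le> B"
  shows "f constant_on UNIV"
proof -
  obtain \<kappa>1 where \<kappa>1: "\<kappa> < \<kappa>1" "\<kappa>1 < pi * \<rho> / 2" using \<kappa>(2) dense by blast
  obtain R N where R: "R > 0" "\<And>v. card (\<Lambda> \<inter> cball v R) \<le> N"
    "\<And>v. exp (\<kappa>1 * R\<^sup>2) * (\<Prod>a\<in>(\<lambda>a. a - v) ` (\<Lambda> \<inter> ball v R). cmod a / R) \<le> 1 / 8"
    using uniform_density_product_small[OF dens _ \<kappa>1(2)] \<kappa>1(1) \<kappa>(1) by (metis less_eq_real_def order_le_less_trans)
  define L where "L = real N * max 1 (2 * R / s) ^ N"
  have "L \<ge> 0" by (simp add: L_def)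
  define e where "e = 1 / (8 * (L + 1))"
  have "e > 0" and Le: "L * e \<le> 1 / 8"
    using \<open>L \<ge> 0\<close> by (auto simp: e_def field_simps)
  have C: "C \<ge> 0" using growth[of 0] by simp (meson norm_ge_zero order_trans)
  have bound: "cmod (f w) \<le> B * exp (\<kappa>1 * R\<^sup>2) / e" if "f w \<noteq> 0" for w
  proof -
    define \<phi> where "\<phi> = (\<lambda>z. cmod (f z) * exp (- \<kappa>1 * (cmod (z - w))\<^sup>2))"
    define M where "M = (SUP z. \<phi> z)"
    have "\<phi> z \<le> C * exp ((\<kappa> + \<kappa>\<^sup>2 / (\<kappa>1 - \<kappa>)) * (cmod w)\<^sup>2)" for z
    proof -
      have "\<phi> z \<le> C * exp (\<kappa> * (cmod z)\<^sup>2) * exp (- \<kappa>1 * (cmod (z - w))\<^sup>2)"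
        unfolding \<phi>_def using growth by (intro mult_right_mono) auto
      also have "\<dots> \<le> C * (exp ((\<kappa> + \<kappa>\<^sup>2 / (\<kappa>1 - \<kappa>)) * (cmod w)\<^sup>2) * exp (\<kappa>1 * (cmod (z - w))\<^sup>2))
          * exp (- \<kappa>1 * (cmod (z - w))\<^sup>2)"
        using C gaussian_weight_shift[OF \<kappa>(1) \<kappa>1(1)] by (intro mult_right_mono mult_left_mono) auto
      also have "\<dots> = C * exp ((\<kappa> + \<kappa>\<^sup>2 / (\<kappa>1 - \<kappa>)) * (cmod w)\<^sup>2)"
        by (simp add: mult.assoc flip: exp_add)
      finally show ?thesis .
    qed
    then have bdd: "bdd_above (range \<phi>)" by (auto simp: bdd_above_def)
    have \<phi>M: "\<phi> z \<le> M" for z unfolding M_def by (rule cSUP_upper[OF _ bdd]) simp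
    have "\<phi> w = cmod (f w)" by (simp add: \<phi>_def)
    then have fM: "cmod (f w) \<le> M" using \<phi>M[of w] by simp
    then have "M > 0" using that by (meson less_le_trans zero_less_norm_iff)
    then have "M / 2 < M" by simp
    then obtain z0 where z0: "\<phi> z0 > M / 2"
      unfolding M_def less_cSUP_iff[OF UNIV_not_empty bdd] by blast
    \<comment> \<open>move the near-maximum to the origin, absorbing the weight into the function\<close>
    define u where "u = z0 - w"
    define F where "F = (\<lambda>z. f (z + z0) * exp (- of_real \<kappa>1 * (2 * z * cnj u + of_real ((cmod u)\<^sup>2))) / of_real M)"
    have FN: "cmod (F z) = \<phi> (z + z0) * exp (\<kappa>1 * (cmod z)\<^sup>2) / M" for z
    proof -
      have "(cmod (z + u))\<^sup>2 = (cmod z)\<^sup>2 + (2 * Re (z * cnj u) + (cmod u)\<^sup>2)"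
        by (simp only: cmod_power2) (simp add: algebra_simps power2_eq_square)
      then have "- \<kappa>1 * (2 * Re (z * cnj u) + (cmod u)\<^sup>2) = - \<kappa>1 * (cmod (z + u))\<^sup>2 + \<kappa>1 * (cmod z)\<^sup>2"
        by (simp add: algebra_simps)
      moreover have "Re (- of_real \<kappa>1 * (2 * z * cnj u + of_real ((cmod u)\<^sup>2))) = - \<kappa>1 * (2 * Re (z * cnj u) + (cmod u)\<^sup>2)"
        by (simp add: algebra_simps)
      ultimately have "norm (exp (- of_real \<kappa>1 * (2 * z * cnj u + of_real ((cmod u)\<^sup>2))))
          = exp (- \<kappa>1 * (cmod (z + u))\<^sup>2) * exp (\<kappa>1 * (cmod z)\<^sup>2)"
        by (simp only: norm_exp_eq_Re exp_add)
      then show ?thesis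
        using \<open>M > 0\<close> unfolding F_def \<phi>_def norm_mult norm_divide
        by (simp add: u_def algebra_simps)
    qed
    let ?S = "(\<lambda>a. a - z0) ` (\<Lambda> \<inter> ball z0 R)"
    have fin: "finite (\<Lambda> \<inter> cball z0 R)" using dens by (auto simp: has_uniform_density_def)
    have sub: "\<Lambda> \<inter> ball z0 R \<subseteq> \<Lambda> \<inter> cball z0 R" by auto
    have "\<exists>a\<in>?S. cmod (F a) > e"
    proof (rule not_all_values_small[where M = "exp (\<kappa>1 * R\<^sup>2)" and N = N and R = R and s = s])
      show "F holomorphic_on UNIV"
        unfolding F_def
        by (intro holomorphic_intros holomorphic_on_compose_gen[OF _ f, unfolded o_def])
           (use \<open>M > 0\<close> in auto)
      show "cmod (F z) \<le> exp (\<kappa>1 * R\<^sup>2)" if "cmod z = R" for z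
        using \<phi>M[of "z + z0"] \<open>M > 0\<close> by (simp add: FN that field_simps)
      show "1 / 2 \<le> cmod (F 0)" using z0 \<open>M > 0\<close> by (simp add: FN field_simps)
      show "finite ?S" using fin sub finite_subset by blast
      show "?S \<subseteq> ball 0 R" by (auto simp: dist_norm norm_minus_commute)
      show "card ?S \<le> N"
        using card_image_le[OF finite_subset[OF sub fin]] card_mono[OF fin sub] R(2)[of z0]
        by (metis order_trans)
      show "s \<le> cmod (a - b)" if "a \<in> ?S" "b \<in> ?S" "a \<noteq> b" for a b
        using that sep by auto
      show "exp (\<kappa>1 * R\<^sup>2) * (\<Prod>a\<in>?S. cmod a / R) \<le> 1 / 8" by (rule R)
      show "real N * max 1 (2 * R / s) ^ N * e \<le> 1 / 8" using Le by (simp add: L_def)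
    qed (use \<open>R > 0\<close> \<open>s > 0\<close> \<open>e > 0\<close> in auto)
    then obtain l where l: "l \<in> \<Lambda>" "l \<in> ball z0 R" "cmod (F (l - z0)) > e" by auto
    have "\<phi> l \<le> cmod (f l) * 1"
      unfolding \<phi>_def using \<kappa>1 \<kappa>(1) by (intro mult_left_mono) auto
    then have "\<phi> l \<le> B" using B[OF l(1)] by simp
    then have "\<phi> l * exp (\<kappa>1 * (cmod (l - z0))\<^sup>2) \<le> B * exp (\<kappa>1 * R\<^sup>2)"
      using l(2) \<kappa>1 \<kappa>(1) order_trans[OF norm_ge_zero B[OF l(1)]]
      by (intro mult_mono) (auto simp: dist_norm norm_minus_commute intro!: mult_left_mono power_mono)
    moreover have "M * e < \<phi> l * exp (\<kappa>1 * (cmod (l - z0))\<^sup>2)"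
      using l(3) \<open>M > 0\<close> by (simp add: FN field_simps)
    ultimately have "M \<le> B * exp (\<kappa>1 * R\<^sup>2) / e" using \<open>e > 0\<close> by (simp add: field_simps)
    then show ?thesis using fM by linarith
  qed
  have "cmod (f w) \<le> max 0 (B * exp (\<kappa>1 * R\<^sup>2) / e)" for w
    using bound[of w] by (cases "f w = 0") (auto simp: le_max_iff_disj)
  then have "bounded (range f)" unfolding bounded_iff by blast
  then show ?thesis by (rule Liouville_theorem[OF f])
qed

section \<open>Phase retrieval for entire functions of Gaussian growth\<close>

lemma uniform_density_unbounded:
  assumes "has_uniform_density U D" "D > 0"
  shows "\<exists>u\<in>U. r \<le> cmod u"
proof -
  have "pi * D / 2 > 0" using assms by simp
  then obtain r0 where r0: "r0 > 0"
    "\<And>z r. r \<ge> r0 \<Longrightarrow> \<bar>real (card (U \<inter> cball z r)) - D * (pi * r\<^sup>2)\<bar> \<le> pi * D / 2 * r\<^sup>2"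
    using has_uniform_densityD[OF assms(1)] by blast
  define z where "z = complex_of_real (\<bar>r\<bar> + r0)"
  have "real (card (U \<inter> cball z r0)) \<ge> D * (pi * r0\<^sup>2) - pi * D / 2 * r0\<^sup>2"
    using r0(2)[of r0 z] by linarith
  also have "D * (pi * r0\<^sup>2) - pi * D / 2 * r0\<^sup>2 = pi * D / 2 * r0\<^sup>2" by (simp add: algebra_simps)
  finally have "card (U \<inter> cball z r0) > 0"
    using assms r0(1) by (metis of_nat_0_less_iff less_le_trans mult_pos_pos zero_less_power \<open>pi * D / 2 > 0\<close>)
  then obtain u where u: "u \<in> U" "cmod (z - u) \<le> r0"
    by (metis Int_iff card_gt_0_iff dist_norm ex_in_conv mem_cball)
  have "cmod z = \<bar>r\<bar> + r0" using r0(1) by (simp add: z_def del: of_real_add)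
  then have "r \<le> cmod u" using u(2) norm_triangle_ineq2[of z u] by linarith
  then show ?thesis using u(1) by blast
qed

text \<open>
  Cauchy's estimate on circles of radius one. The shift from \<open>\<bar>w\<bar>\<close> to \<open>\<bar>w\<bar> + 2\<close> accounts for the disc around
  \<open>w\<close> in which \<open>z\<close> lies and for that circle; only lower-order terms of the exponent are affected.
\<close>

lemma gaussian_growth_derivs:
  fixes f :: "complex \<Rightarrow> complex"
  assumes f: "f holomorphic_on UNIV" and "\<kappa> \<ge> 0"
    and growth: "\<And>z. cmod (f z) \<le> C * exp (\<kappa> * (cmod z)\<^sup>2)"
    and "n \<le> 2" "cmod (z - w) \<le> 1"
  shows "cmod ((deriv ^^ n) f z) \<le> 2 * C * exp (\<kappa> * (cmod w + 2)\<^sup>2)"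
proof -
  have C: "C \<ge> 0" using growth[of 0] by simp (meson norm_ge_zero order_trans)
  have "cmod ((deriv ^^ n) f z) \<le> fact n * (C * exp (\<kappa> * (cmod w + 2)\<^sup>2)) / 1 ^ n"
  proof (rule Cauchy_inequality)
    show "f holomorphic_on ball z 1" "continuous_on (cball z 1) f"
      using f holomorphic_on_subset holomorphic_on_imp_continuous_on by blast+
    show "cmod (f x) \<le> C * exp (\<kappa> * (cmod w + 2)\<^sup>2)" if "cmod (z - x) = 1" for x
    proof -
      have "cmod x \<le> cmod w + 2"
        using that assms(5) norm_triangle_ineq2[of x z] norm_triangle_ineq2[of z w]
        by (simp add: norm_minus_commute)
      then have "C * exp (\<kappa> * (cmod x)\<^sup>2) \<le> C * exp (\<kappa> * (cmod w + 2)\<^sup>2)"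
        using C \<open>\<kappa> \<ge> 0\<close> by (intro mult_left_mono) (auto intro!: mult_left_mono power_mono)
      then show ?thesis using growth[of x] by linarith
    qed
  qed simp
  also have "\<dots> \<le> 2 * (C * exp (\<kappa> * (cmod w + 2)\<^sup>2))"
  proof -
    have "n = 0 \<or> n = 1 \<or> n = 2" using assms(4) by auto
    then have "(fact n :: real) \<le> 2" by auto
    then show ?thesis using C by (simp add: mult_right_mono)
  qed
  finally show ?thesis by simp
qed

text \<open>
  The complex number \<open>deriv f w * cnj (f w)\<close> encodes the gradient of \<open>\<bar>f\<bar>\<^sup>2\<close> at \<open>w\<close>: its real part is half the
  derivative in direction \<open>1\<close>, minus its imaginary part half the derivative in direction \<open>\<i>\<close>.
\<close>

lemma square_modulus_first_order:
  fixes f :: "complex \<Rightarrow> complex"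
  assumes f: "f holomorphic_on UNIV"
    and B: "\<And>n z. n \<le> 2 \<Longrightarrow> cmod (z - w) \<le> 1 \<Longrightarrow> cmod ((deriv ^^ n) f z) \<le> B"
    and s: "cmod s \<le> 1"
  shows "\<bar>(cmod (f (w + s)))\<^sup>2 - (cmod (f w))\<^sup>2 - 2 * Re (s * (deriv f w * cnj (f w)))\<bar>
           \<le> 6 * (cmod s)\<^sup>2 * B\<^sup>2"
proof -
  define E where "E = f (w + s) - (f w + deriv f w * s)"
  have B0: "cmod (f w) \<le> B" "cmod (deriv f w) \<le> B" "0 \<le> B"
    using B[of 0 w] B[of 1 w] order_trans[OF norm_ge_zero] by auto
  have "cmod ((deriv ^^ 0) f (w + s) - (\<Sum>i\<le>1. (deriv ^^ i) f w * (w + s - w) ^ i / fact i))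
      \<le> B * cmod (w + s - w) ^ Suc 1 / fact 1"
  proof (rule complex_Taylor[where S = "cball w 1" and f = "\<lambda>n. (deriv ^^ n) f"])
    show "((deriv ^^ i) f has_field_derivative (deriv ^^ Suc i) f x) (at x within cball w 1)" for i x
    proof -
      have "(deriv ^^ i) f holomorphic_on UNIV"
        using f by (rule holomorphic_higher_deriv) simp
      then have "((deriv ^^ i) f has_field_derivative deriv ((deriv ^^ i) f) x) (at x)"
        by (rule holomorphic_derivI) auto
      then show ?thesis by (simp add: has_field_derivative_at_within)
    qed
    show "cmod ((deriv ^^ Suc 1) f x) \<le> B" if "x \<in> cball w 1" for x
      using that B[of 2 x] by (simp add: dist_norm norm_minus_commute numeral_2_eq_2)
  qed (use s in \<open>auto simp: dist_norm\<close>)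
  then have E: "cmod E \<le> B * (cmod s)\<^sup>2"
    by (simp add: E_def algebra_simps power2_eq_square)
  also have "\<dots> \<le> B * (cmod s * 1)"
    unfolding power2_eq_square using s B0 by (intro mult_left_mono) auto
  finally have E1: "cmod E \<le> B * cmod s" by simp
  have "f (w + s) = f w + (deriv f w * s + E)" by (simp add: E_def)
  moreover have "(cmod (x + y))\<^sup>2 = (cmod x)\<^sup>2 + 2 * Re (y * cnj x) + (cmod y)\<^sup>2" for x y :: complex
    by (simp only: cmod_power2) (simp add: algebra_simps power2_eq_square)
  ultimately have "(cmod (f (w + s)))\<^sup>2 - (cmod (f w))\<^sup>2 - 2 * Re (s * (deriv f w * cnj (f w)))
      = 2 * Re (E * cnj (f w)) + (cmod (deriv f w * s + E))\<^sup>2"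
    by (simp add: algebra_simps)
  also have "\<bar>\<dots>\<bar> \<le> 2 * (B * (cmod s)\<^sup>2 * B) + (2 * B * cmod s)\<^sup>2"
  proof -
    have "\<bar>Re (E * cnj (f w))\<bar> \<le> cmod E * cmod (f w)"
      using abs_Re_le_cmod[of "E * cnj (f w)"] by (simp add: norm_mult)
    also have "\<dots> \<le> B * (cmod s)\<^sup>2 * B"
      using E B0 by (intro mult_mono) auto
    finally have 1: "\<bar>Re (E * cnj (f w))\<bar> \<le> B * (cmod s)\<^sup>2 * B" .
    have "cmod (deriv f w * s) \<le> B * cmod s"
      unfolding norm_mult using B0 by (intro mult_right_mono) auto
    then have "cmod (deriv f w * s + E) \<le> 2 * B * cmod s"
      using E1 norm_triangle_ineq[of "deriv f w * s" E] by linarith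
    then have "(cmod (deriv f w * s + E))\<^sup>2 \<le> (2 * B * cmod s)\<^sup>2"
      by (intro power_mono) auto
    then show ?thesis using 1 zero_le_power2[of "cmod (deriv f w * s + E)"] by linarith
  qed
  also have "\<dots> = 6 * (cmod s)\<^sup>2 * B\<^sup>2" by (simp add: power2_eq_square)
  finally show ?thesis .
qed

text \<open>
  Equal moduli at \<open>w\<close>, \<open>w + s\<close> and \<open>w + \<i> t\<close> make the gradients of \<open>\<bar>f\<bar>\<^sup>2\<close> and \<open>\<bar>h\<bar>\<^sup>2\<close> at \<open>w\<close> agree up to an error of
  the order of the distances. The factor \<open>(f w)\<^sup>2\<close> is what converts this non-holomorphic
  information into a statement about a holomorphic function.
\<close>

lemma wronskian_bound_of_equal_moduli:
  fixes f h :: "complex \<Rightarrow> complex"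
  assumes f: "f holomorphic_on UNIV" and h: "h holomorphic_on UNIV"
    and Bf: "\<And>n z. n \<le> 2 \<Longrightarrow> cmod (z - w) \<le> 1 \<Longrightarrow> cmod ((deriv ^^ n) f z) \<le> B"
    and Bh: "\<And>n z. n \<le> 2 \<Longrightarrow> cmod (z - w) \<le> 1 \<Longrightarrow> cmod ((deriv ^^ n) h z) \<le> B"
    and e: "e \<le> 1" "s \<noteq> 0" "\<bar>s\<bar> \<le> e" "t \<noteq> 0" "\<bar>t\<bar> \<le> e"
    and eq: "cmod (f w) = cmod (h w)" "cmod (f (w + of_real s)) = cmod (h (w + of_real s))"
      "cmod (f (w + \<i> * of_real t)) = cmod (h (w + \<i> * of_real t))"
  shows "cmod ((f w)\<^sup>2 * (deriv f w * h w - f w * deriv h w)) \<le> 12 * e * B ^ 4"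
proof -
  define X where "X = deriv f w * cnj (f w) - deriv h w * cnj (h w)"
  have B0: "cmod (f w) \<le> B" "cmod (h w) \<le> B" "0 \<le> B"
    using Bf[of 0 w] Bh[of 0 w] order_trans[OF norm_ge_zero] by auto
  have dir: "\<bar>Re (v * X)\<bar> \<le> 6 * (cmod v)\<^sup>2 * B\<^sup>2"
    if v: "cmod v \<le> 1" "cmod (f (w + v)) = cmod (h (w + v))" for v
  proof -
    have "v * X = v * (deriv f w * cnj (f w)) - v * (deriv h w * cnj (h w))"
      by (simp add: X_def algebra_simps)
    then have "Re (v * X) = Re (v * (deriv f w * cnj (f w))) - Re (v * (deriv h w * cnj (h w)))"
      by simp
    then show ?thesis
      using square_modulus_first_order[where w = w and B = B, OF f Bf v(1)]
        square_modulus_first_order[where w = w and B = B, OF h Bh v(1)] v(2) eq(1)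
      by simp
  qed
  have "\<bar>s\<bar> * \<bar>Re X\<bar> \<le> 6 * \<bar>s\<bar>\<^sup>2 * B\<^sup>2"
    using dir[of "of_real s"] e eq by (simp add: abs_mult norm_mult)
  then have "\<bar>s\<bar> * \<bar>Re X\<bar> \<le> \<bar>s\<bar> * (6 * \<bar>s\<bar> * B\<^sup>2)"
    by (simp only: power2_eq_square mult.assoc mult.left_commute)
  then have "\<bar>Re X\<bar> \<le> 6 * \<bar>s\<bar> * B\<^sup>2"
    by (rule mult_left_le_imp_le) (use e in simp)
  moreover have "6 * \<bar>s\<bar> * B\<^sup>2 \<le> 6 * e * B\<^sup>2" using e by (intro mult_right_mono) auto
  moreover have "\<bar>t\<bar> * \<bar>Im X\<bar> \<le> 6 * \<bar>t\<bar>\<^sup>2 * B\<^sup>2"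
    using dir[of "\<i> * of_real t"] e eq by (simp add: abs_mult norm_mult)
  then have "\<bar>t\<bar> * \<bar>Im X\<bar> \<le> \<bar>t\<bar> * (6 * \<bar>t\<bar> * B\<^sup>2)"
    by (simp only: power2_eq_square mult.assoc mult.left_commute)
  then have "\<bar>Im X\<bar> \<le> 6 * \<bar>t\<bar> * B\<^sup>2"
    by (rule mult_left_le_imp_le) (use e in simp)
  moreover have "6 * \<bar>t\<bar> * B\<^sup>2 \<le> 6 * e * B\<^sup>2" using e by (intro mult_right_mono) auto
  ultimately have X: "cmod X \<le> 12 * e * B\<^sup>2" using cmod_le[of X] by linarith
  have "f w * cnj (f w) = h w * cnj (h w)"
    using eq(1) by (simp flip: complex_norm_square)
  then have "f w * cnj (f w) * (deriv f w * h w - f w * deriv h w) = f w * h w * X"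
    unfolding X_def by algebra
  then have "cmod (f w) * cmod (f w) * cmod (deriv f w * h w - f w * deriv h w) = cmod (f w) * cmod (h w) * cmod X"
    by (metis complex_mod_cnj norm_mult)
  then have "cmod ((f w)\<^sup>2 * (deriv f w * h w - f w * deriv h w)) = cmod (f w) * cmod (h w) * cmod X"
    by (simp add: norm_mult power2_eq_square)
  also have "\<dots> \<le> B * B * (12 * e * B\<^sup>2)"
    using X B0 by (intro mult_mono) auto
  finally show ?thesis by (simp add: power2_eq_square power4_eq_xxxx algebra_simps)
qed

lemma wronskian_zero_imp_proportional:
  fixes f h :: "complex \<Rightarrow> complex"
  assumes f: "f holomorphic_on UNIV" and h: "h holomorphic_on UNIV"
    and "f z0 \<noteq> 0" and zero: "\<And>z. (f z)\<^sup>2 * (deriv f z * h z - f z * deriv h z) = 0"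
  obtains k where "\<And>z. h z = k * f z"
proof -
  have "isCont f z0"
    using f holomorphic_on_imp_continuous_on continuous_on_eq_continuous_at open_UNIV by blast
  then obtain r where r: "r > 0" "\<And>z. dist z0 z < r \<Longrightarrow> f z \<noteq> 0"
    using continuous_at_avoid[of z0 f 0] \<open>f z0 \<noteq> 0\<close> by blast
  have "((\<lambda>z. h z / f z) has_field_derivative 0) (at z within ball z0 r)" if z: "z \<in> ball z0 r" for z
  proof -
    have fz: "f z \<noteq> 0" using z r by auto
    have df: "(f has_field_derivative deriv f z) (at z)" using f by (intro holomorphic_derivI) auto
    have dh: "(h has_field_derivative deriv h z) (at z)" using h by (intro holomorphic_derivI) auto
    have "((\<lambda>z. h z / f z) has_field_derivative (deriv h z * f z - h z * deriv f z) / (f z * f z)) (at z)"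
      by (rule DERIV_divide[OF dh df fz])
    moreover have "deriv h z * f z - h z * deriv f z = 0"
      using zero[of z] fz by (simp add: algebra_simps)
    ultimately show ?thesis by (simp add: has_field_derivative_at_within)
  qed
  then obtain k where k: "\<And>z. z \<in> ball z0 r \<Longrightarrow> h z / f z = k"
    using has_field_derivative_zero_constant[of "ball z0 r" "\<lambda>z. h z / f z"] by (metis convex_ball)
  have "h z = k * f z" for z
  proof (rule analytic_continuation_open[of "ball z0 r" UNIV h "\<lambda>z. k * f z"])
    show "h z = k * f z" if "z \<in> ball z0 r" for z
      using k[OF that] r(2)[of z] that by (auto simp: field_simps)
    show "(\<lambda>z. k * f z) holomorphic_on UNIV" using f by (intro holomorphic_intros)
  qed (use h r in auto)
  then show ?thesis using that by blast
qed

lemma vanishing_on_dense_set_imp_zero: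
  fixes f :: "complex \<Rightarrow> complex"
  assumes f: "f holomorphic_on UNIV"
    and growth: "\<And>z. cmod (f z) \<le> C * exp (\<kappa> * (cmod z)\<^sup>2)"
    and dens: "has_uniform_density \<Lambda> \<rho>" and \<kappa>: "0 \<le> \<kappa>" "\<kappa> < pi * \<rho> / 2"
    and "s > 0" and sep: "\<And>a b. a \<in> \<Lambda> \<Longrightarrow> b \<in> \<Lambda> \<Longrightarrow> a \<noteq> b \<Longrightarrow> s \<le> cmod (a - b)"
    and "\<eta> > 0" and decay: "\<And>a. a \<in> \<Lambda> \<Longrightarrow> cmod (f a) \<le> K * exp (- \<eta> * (cmod a)\<^sup>2)"
  shows "f z = 0"
proof -
  have K: "cmod (f a) \<le> \<bar>K\<bar>" if "a \<in> \<Lambda>" for a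
  proof -
    have "K * exp (- \<eta> * (cmod a)\<^sup>2) \<le> \<bar>K\<bar> * 1" using \<open>\<eta> > 0\<close> by (intro mult_mono) auto
    then show ?thesis using decay[OF that] by linarith
  qed
  have "f constant_on UNIV"
    by (rule bounded_on_dense_set_imp_constant[OF f growth dens \<kappa> \<open>s > 0\<close> sep K])
  then obtain c where c: "\<And>z. f z = c" by (auto simp: constant_on_def)
  have "\<rho> > 0" using \<kappa> by (smt (verit) divide_nonpos_pos mult_nonneg_nonpos pi_gt_zero)
  have "cmod c \<le> \<bar>K\<bar> * exp (- \<eta> * r\<^sup>2)" if "r \<ge> 0" for r
  proof -
    obtain a where a: "a \<in> \<Lambda>" "r \<le> cmod a"
      using uniform_density_unbounded[OF dens \<open>\<rho> > 0\<close>] by blast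
    have "cmod c \<le> K * exp (- \<eta> * (cmod a)\<^sup>2)" using decay[OF a(1)] by (simp add: c)
    also have "\<dots> \<le> \<bar>K\<bar> * exp (- \<eta> * r\<^sup>2)"
      using a(2) that \<open>\<eta> > 0\<close> by (intro mult_mono) (auto intro!: mult_left_mono power_mono)
    finally show ?thesis .
  qed
  then have "\<forall>\<^sub>F r in at_top. cmod c \<le> \<bar>K\<bar> * exp (- \<eta> * r\<^sup>2)"
    using eventually_ge_at_top[of "0::real"] by (rule eventually_mono[rotated])
  moreover have "((\<lambda>r. \<bar>K\<bar> * exp (- \<eta> * r\<^sup>2)) \<longlongrightarrow> \<bar>K\<bar> * 0) at_top"
    using \<open>\<eta> > 0\<close> by (intro tendsto_mult tendsto_const) real_asymp
  ultimately have "cmod c \<le> \<bar>K\<bar> * 0"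
    by (intro tendsto_lowerbound) auto
  then show ?thesis by (simp add: c)
qed

text \<open>
  The three points around \<open>a\<close> are so close together that the constant \<open>8 > 2 \<pi>\<close> in the exponent outweighs the growth of the
  product of the four factors in the Wronskian expression.
\<close>

theorem entire_phase_retrieval:
  fixes f h :: "complex \<Rightarrow> complex"
  assumes f: "f holomorphic_on UNIV" and h: "h holomorphic_on UNIV"
    and gf: "\<And>z. cmod (f z) \<le> C * exp (pi / 2 * (cmod z)\<^sup>2)"
    and gh: "\<And>z. cmod (h z) \<le> C * exp (pi / 2 * (cmod z)\<^sup>2)"
    and dens: "has_uniform_density \<Lambda> \<rho>" and \<rho>: "\<rho> > 4"
    and "s > 0" and sep: "\<And>a b. a \<in> \<Lambda> \<Longrightarrow> b \<in> \<Lambda> \<Longrightarrow> a \<noteq> b \<Longrightarrow> s \<le> cmod (a - b)"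
    and p: "\<And>a. a \<in> \<Lambda> \<Longrightarrow> p a \<noteq> 0 \<and> \<bar>p a\<bar> \<le> exp (- 8 * (cmod a + 2)\<^sup>2)"
    and q: "\<And>a. a \<in> \<Lambda> \<Longrightarrow> q a \<noteq> 0 \<and> \<bar>q a\<bar> \<le> exp (- 8 * (cmod a + 2)\<^sup>2)"
    and eq: "\<And>a. a \<in> \<Lambda> \<Longrightarrow> cmod (f a) = cmod (h a)"
      "\<And>a. a \<in> \<Lambda> \<Longrightarrow> cmod (f (a + of_real (p a))) = cmod (h (a + of_real (p a)))"
      "\<And>a. a \<in> \<Lambda> \<Longrightarrow> cmod (f (a + \<i> * of_real (q a))) = cmod (h (a + \<i> * of_real (q a)))"
  obtains c where "cmod c = 1" "\<And>z. f z = c * h z"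
proof -
  have C: "C \<ge> 0" using gf[of 0] by simp (meson norm_ge_zero order_trans)
  define W where "W = (\<lambda>z. (f z)\<^sup>2 * (deriv f z * h z - f z * deriv h z))"
  define B where "B = (\<lambda>z. 2 * C * exp (pi / 2 * (cmod z + 2)\<^sup>2))"
  have B4: "B z ^ 4 = 16 * C ^ 4 * exp (2 * pi * (cmod z + 2)\<^sup>2)" for z
    by (simp add: B_def power_mult_distrib exp_of_nat_mult[symmetric] algebra_simps)
  have Bf: "cmod ((deriv ^^ n) f z) \<le> B a" if "n \<le> 2" "cmod (z - a) \<le> 1" for n z a
    unfolding B_def using gf that by (intro gaussian_growth_derivs[OF f]) auto
  have Bh: "cmod ((deriv ^^ n) h z) \<le> B a" if "n \<le> 2" "cmod (z - a) \<le> 1" for n z a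
    unfolding B_def using gh that by (intro gaussian_growth_derivs[OF h]) auto
  have pi4: "pi / 2 < pi * \<rho> / 2" using \<rho> by simp
  have "2 * pi < pi * \<rho> / 2" using \<rho> by (simp add: field_simps)
  then obtain \<kappa> where \<kappa>: "2 * pi < \<kappa>" "\<kappa> < pi * \<rho> / 2" using dense by blast
  have W0: "W z = 0" for z
  proof (rule vanishing_on_dense_set_imp_zero[OF _ _ dens _ \<kappa>(2) \<open>s > 0\<close> sep,
        where f = W and \<eta> = "8 - 2 * pi" and K = "192 * C ^ 4"
          and z = z and C = "32 * C ^ 4 * exp ((2 * pi + (2 * pi)\<^sup>2 / (\<kappa> - 2 * pi)) * 4)"])
    show "W holomorphic_on UNIV"
      unfolding W_def using f h by (intro holomorphic_intros) auto
    show "cmod (W z) \<le> 32 * C ^ 4 * exp ((2 * pi + (2 * pi)\<^sup>2 / (\<kappa> - 2 * pi)) * 4) * exp (\<kappa> * (cmod z)\<^sup>2)" for z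
    proof -
      have b: "cmod (f z) \<le> B z" "cmod (h z) \<le> B z" "cmod (deriv f z) \<le> B z" "cmod (deriv h z) \<le> B z"
        using Bf[of 0 z z] Bh[of 0 z z] Bf[of 1 z z] Bh[of 1 z z] by auto
      have "B z \<ge> 0" using C by (simp add: B_def)
      have "cmod (deriv f z * h z - f z * deriv h z) \<le> B z * B z + B z * B z"
        by (rule order_trans[OF norm_triangle_ineq4 add_mono])
           (use b \<open>B z \<ge> 0\<close> in \<open>auto simp: norm_mult intro!: mult_mono\<close>)
      moreover have "cmod ((f z)\<^sup>2) \<le> (B z)\<^sup>2"
        using b(1) by (simp add: norm_power power_mono)
      ultimately have "cmod (W z) \<le> (B z)\<^sup>2 * (B z * B z + B z * B z)"
        unfolding W_def norm_mult[of "(f z)\<^sup>2"] by (intro mult_mono) auto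
      also have "\<dots> = 2 * B z ^ 4" by (simp add: power2_eq_square power4_eq_xxxx)
      also have "\<dots> = 32 * C ^ 4 * exp (2 * pi * (cmod z + 2)\<^sup>2)" by (simp add: B4)
      also have "exp (2 * pi * (cmod z + 2)\<^sup>2)
          \<le> exp ((2 * pi + (2 * pi)\<^sup>2 / (\<kappa> - 2 * pi)) * 4) * exp (\<kappa> * (cmod z)\<^sup>2)"
      proof -
        have "cmod (of_real (cmod z + 2)) = cmod z + 2"
          by (subst norm_of_real) simp
        then show ?thesis
          using gaussian_weight_shift[OF _ \<kappa>(1), of "of_real (cmod z + 2)" 2] by simp
      qed
      finally show ?thesis using C by (simp add: mult.assoc mult_left_mono)
    qed
    show "8 - 2 * pi > 0" using pi_less_4 by simp
    show "cmod (W a) \<le> 192 * C ^ 4 * exp (- (8 - 2 * pi) * (cmod a)\<^sup>2)" if a: "a \<in> \<Lambda>" for a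
    proof -
      have "cmod (W a) \<le> 12 * exp (- 8 * (cmod a + 2)\<^sup>2) * B a ^ 4"
        unfolding W_def
        by (rule wronskian_bound_of_equal_moduli[where w = a and B = "B a" and s = "p a" and t = "q a", OF f h Bf Bh])
           (use p[OF a] q[OF a] eq a in auto)
      also have "\<dots> = 192 * C ^ 4 * exp (- (8 - 2 * pi) * (cmod a + 2)\<^sup>2)"
        by (simp add: B4 algebra_simps flip: exp_add)
      also have "exp (- (8 - 2 * pi) * (cmod a + 2)\<^sup>2) \<le> exp (- (8 - 2 * pi) * (cmod a)\<^sup>2)"
        using pi_less_4 by (auto intro!: mult_left_mono power_mono)
      finally show ?thesis using C by (simp add: mult_left_mono)
    qed
  qed (use \<kappa> pi_gt_zero in linarith)
  show ?thesis
  proof (cases "\<forall>a\<in>\<Lambda>. f a = 0")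
    case True
    have "f z = 0" for z
      by (rule vanishing_on_dense_set_imp_zero[OF f gf dens _ pi4 \<open>s > 0\<close> sep, of 1 0])
         (use True in auto)
    moreover have "h z = 0" for z
      by (rule vanishing_on_dense_set_imp_zero[OF h gh dens _ pi4 \<open>s > 0\<close> sep, of 1 0])
         (use True eq(1) in auto)
    ultimately show ?thesis using that[of 1] by simp
  next
    case False
    then obtain a where a: "a \<in> \<Lambda>" "f a \<noteq> 0" by blast
    obtain k where k: "\<And>z. h z = k * f z"
      using wronskian_zero_imp_proportional[OF f h a(2)] W0 unfolding W_def by blast
    have "cmod k = 1" using eq(1)[OF a(1)] a(2) by (simp add: k norm_mult)
    then have "k \<noteq> 0" by auto
    then have "f z = inverse k * h z" for z by (simp add: k)
    then show ?thesis using that[of "inverse k"] \<open>cmod k = 1\<close> by (simp add: norm_inverse)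
  qed
qed

section \<open>Fourier uniqueness and the Bargmann transform\<close>

text \<open>
  The positive and the negative part of \<open>r\<close> have the same integral and, after normalisation, are densities
  of probability distributions with the same characteristic function; by Levy's theorem they agree.
\<close>

lemma fourier_uniqueness_real:
  fixes r :: "real \<Rightarrow> real"
  assumes r: "integrable lborel r"
    and zero: "\<And>w. (LINT t|lborel. of_real (r t) * iexp (w * t)) = 0"
  shows "AE t in lborel. r t = 0"
proof -
  have [measurable]: "r \<in> borel_measurable borel" using borel_measurable_integrable[OF r] by simp
  define p where "p = (\<lambda>t. max (r t) 0)"
  define n where "n = (\<lambda>t. max (- r t) 0)"
  have [measurable]: "p \<in> borel_measurable borel" "n \<in> borel_measurable borel"
    unfolding p_def n_def by measurable
  have ip: "integrable lborel p" and i_n: "integrable lborel n"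
    using r unfolding p_def n_def by auto
  have pn: "r t = p t - n t" "p t \<ge> 0" "n t \<ge> 0" for t by (auto simp: p_def n_def)
  have char_eq: "(LINT t|lborel. of_real (p t) * iexp (w * t)) = (LINT t|lborel. of_real (n t) * iexp (w * t))" for w
  proof -
    have i: "integrable lborel (\<lambda>t. of_real (q t) * iexp (w * t))" if "integrable lborel q" "q \<in> borel_measurable borel" for q :: "real \<Rightarrow> real"
      using that by (intro Bochner_Integration.integrable_bound[OF that(1)]) (auto simp: norm_mult)
    have "(LINT t|lborel. of_real (p t) * iexp (w * t)) - (LINT t|lborel. of_real (n t) * iexp (w * t)) = (LINT t|lborel. of_real (r t) * iexp (w * t))"
      unfolding Bochner_Integration.integral_diff[symmetric, OF i[OF ip \<open>p \<in> borel_measurable borel\<close>] i[OF i_n \<open>n \<in> borel_measurable borel\<close>]]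
      by (intro Bochner_Integration.integral_cong) (auto simp: pn(1) algebra_simps)
    then show ?thesis using zero[of w] by simp
  qed
  define m where "m = (LINT t|lborel. p t)"
  have m': "m = (LINT t|lborel. n t)"
    using char_eq[of 0] by (simp add: m_def)
  have "AE t in lborel. p t = n t"
  proof (cases "m = 0")
    case True
    then have "AE t in lborel. p t = 0" "AE t in lborel. n t = 0"
      using integral_nonneg_eq_0_iff_AE[OF ip] integral_nonneg_eq_0_iff_AE[OF i_n] pn m' by (auto simp: m_def)
    then show ?thesis by eventually_elim simp
  next
    case False
    have "m \<ge> 0" unfolding m_def using pn by (intro integral_nonneg_AE) auto
    with False have "m > 0" by simp
    have rd: "real_distribution (density lborel (\<lambda>t. ennreal (q t / m)))"
      if "integrable lborel q" "\<And>t. q t \<ge> 0" "m = (LINT t|lborel. q t)" for q :: "real \<Rightarrow> real"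
    proof -
      have [measurable]: "q \<in> borel_measurable borel" using that(1) by simp
      have "(\<integral>\<^sup>+t. ennreal (q t / m) \<partial>lborel) = ennreal (LINT t|lborel. q t / m)"
        using that \<open>m > 0\<close> by (intro nn_integral_eq_integral) auto
      also have "(LINT t|lborel. q t / m) = 1" using that(3) \<open>m > 0\<close> by simp
      finally have "prob_space (density lborel (\<lambda>t. ennreal (q t / m)))"
        by (intro prob_spaceI) (simp add: emeasure_density)
      then show ?thesis by (simp add: real_distribution_def real_distribution_axioms_def)
    qed
    have ch: "char (density lborel (\<lambda>t. ennreal (q t / m))) w = (LINT t|lborel. of_real (q t) * iexp (w * t)) / of_real m"
      if "q \<in> borel_measurable borel" "\<And>t. q t \<ge> 0" for q :: "real \<Rightarrow> real" and w
    proof -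
      have [measurable]: "q \<in> borel_measurable borel" by fact
      have "char (density lborel (\<lambda>t. ennreal (q t / m))) w = (LINT t|lborel. (q t / m) *\<^sub>R iexp (w * t))"
        unfolding char_def using that(2) \<open>m > 0\<close> by (subst integral_density) auto
      also have "\<dots> = (LINT t|lborel. of_real (q t) * iexp (w * t) / of_real m)"
        by (intro Bochner_Integration.integral_cong) (auto simp: scaleR_conv_of_real)
      finally show ?thesis by simp
    qed
    have "density lborel (\<lambda>t. ennreal (p t / m)) = density lborel (\<lambda>t. ennreal (n t / m))"
    proof (rule Levy_uniqueness)
      show "char (density lborel (\<lambda>t. ennreal (p t / m))) = char (density lborel (\<lambda>t. ennreal (n t / m)))"
        by (rule ext) (simp only: ch[OF \<open>p \<in> borel_measurable borel\<close> pn(2)]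
            ch[OF \<open>n \<in> borel_measurable borel\<close> pn(3)] char_eq)
    qed (rule rd[OF ip pn(2) m_def] rd[OF i_n pn(3) m'])+
    then have "AE t in lborel. ennreal (p t / m) = ennreal (n t / m)"
      by (rule sigma_finite_measure.density_unique[OF sigma_finite_lborel, rotated 2]) auto
    then show ?thesis
      using pn \<open>m > 0\<close> by (auto simp: ennreal_inj elim!: eventually_mono)
  qed
  then show ?thesis by eventually_elim (simp add: pn)
qed

lemma continuous_imp_lebesgue_measurable:
  fixes f :: "real \<Rightarrow> complex"
  assumes "continuous_on UNIV f"
  shows "f \<in> borel_measurable lebesgue"
  by (rule measurable_completion) (use assms in \<open>simp add: borel_measurable_continuous_onI\<close>)

text \<open>
  Conjugation shows that the Fourier transform of \<open>cnj \<circ> f\<close> vanishes as well, so the real and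
  imaginary part can be treated separately; each is replaced by a Borel function to reach \<open>lborel\<close>.
\<close>

lemma fourier_uniqueness:
  fixes f :: "real \<Rightarrow> complex"
  assumes f: "integrable lebesgue f"
    and zero: "\<And>w. (LINT t|lebesgue. f t * iexp (w * t)) = 0"
  shows "AE t in lebesgue. f t = 0"
proof -
  have fm: "f \<in> borel_measurable lebesgue" using f by simp
  have em: "(\<lambda>t. iexp (w * t)) \<in> borel_measurable lebesgue" for w
    by (intro continuous_imp_lebesgue_measurable continuous_intros)
  have i: "integrable lebesgue (\<lambda>t. q t * iexp (w * t))" if "integrable lebesgue q" for q w
    by (rule Bochner_Integration.integrable_bound[OF that])
       (use that em in \<open>auto simp: norm_mult intro!: borel_measurable_times\<close>)
  have cf: "integrable lebesgue (\<lambda>t. cnj (f t))" using f by (rule integrable_cnj)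
  have zero': "(LINT t|lebesgue. cnj (f t) * iexp (w * t)) = 0" for w
  proof -
    have "(LINT t|lebesgue. cnj (f t) * iexp (w * t)) = (LINT t|lebesgue. cnj (f t * iexp (- w * t)))"
      by (intro Bochner_Integration.integral_cong) (auto simp: exp_cnj)
    also have "\<dots> = cnj (LINT t|lebesgue. f t * iexp (- w * t))"
      by (rule Bochner_Integration.integral_cnj)
    finally show ?thesis using zero[of "- w"] by simp
  qed
  have part: "AE t in lebesgue. q t = 0"
    if q: "integrable lebesgue q" "\<And>w. (LINT t|lebesgue. of_real (q t) * iexp (w * t)) = 0" for q :: "real \<Rightarrow> real"
  proof -
    obtain r where r: "r \<in> borel_measurable lborel" "AE t in lborel. q t = r t"
      using completion_ex_borel_measurable_real[of q lborel] q(1) by auto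
    then have [measurable]: "r \<in> borel_measurable borel" by simp
    have rl: "r \<in> borel_measurable lebesgue" using r(1) by (rule measurable_completion)
    have ae: "AE t in lebesgue. q t = r t" using r(2) by (rule AE_completion)
    have ri: "integrable lebesgue r"
      using integrable_cong_AE[THEN iffD1, OF _ rl ae q(1)] q(1) by simp
    have "AE t in lborel. r t = 0"
    proof (rule fourier_uniqueness_real)
      show "integrable lborel r" using ri by (simp add: integrable_completion)
      show "(LINT t|lborel. of_real (r t) * iexp (w * t)) = 0" for w
      proof -
        have m: "(\<lambda>t. of_real (r t) * iexp (w * t)) \<in> borel_measurable lborel" by measurable
        have "(LINT t|lborel. of_real (r t) * iexp (w * t)) = (LINT t|lebesgue. of_real (r t) * iexp (w * t))"
          by (rule integral_completion[symmetric, OF m])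
        also have "\<dots> = (LINT t|lebesgue. of_real (q t) * iexp (w * t))"
        proof (rule integral_cong_AE)
          show "(\<lambda>t. of_real (r t) * iexp (w * t)) \<in> borel_measurable lebesgue"
            by (rule measurable_completion[OF m])
          show "(\<lambda>t. of_real (q t) * iexp (w * t)) \<in> borel_measurable lebesgue"
            by (rule borel_measurable_integrable[OF i[OF integrable_of_real[OF q(1)]]])
          show "AE t in lebesgue. complex_of_real (r t) * iexp (w * t) = of_real (q t) * iexp (w * t)"
            using ae by eventually_elim simp
        qed
        finally show ?thesis using q(2) by simp
      qed
    qed
    then have "AE t in lebesgue. r t = 0" by (rule AE_completion)
    with ae show ?thesis by eventually_elim simp
  qed
  have "AE t in lebesgue. Re (f t) = 0"
  proof (rule part)
    fix w
    have "(LINT t|lebesgue. of_real (Re (f t)) * iexp (w * t))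
        = (LINT t|lebesgue. (f t * iexp (w * t) + cnj (f t) * iexp (w * t)) / 2)"
      by (intro Bochner_Integration.integral_cong) (auto simp: complex_eq_iff algebra_simps)
    also have "\<dots> = 0" using i[OF f] i[OF cf] zero zero' by simp
    finally show "(LINT t|lebesgue. of_real (Re (f t)) * iexp (w * t)) = 0" .
  qed (use f in auto)
  moreover have "AE t in lebesgue. Im (f t) = 0"
  proof (rule part)
    fix w
    have "(LINT t|lebesgue. of_real (Im (f t)) * iexp (w * t))
        = (LINT t|lebesgue. (f t * iexp (w * t) - cnj (f t) * iexp (w * t)) / (2 * \<i>))"
      by (intro Bochner_Integration.integral_cong refl)
         (simp only: left_diff_distrib[symmetric] complex_diff_cnj, simp add: mult_ac)
    also have "\<dots> = 0" using i[OF f] i[OF cf] zero zero' by simp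
    finally show "(LINT t|lebesgue. of_real (Im (f t)) * iexp (w * t)) = 0" .
  qed (use f in auto)
  ultimately show ?thesis by eventually_elim (simp add: complex_eq_iff)
qed

text \<open>
  Differentiation under the integral sign. Difference quotients with increment of modulus below one are
  dominated through \<open>exp (2 \<bar>t\<bar>) \<le> exp (2 t) + exp (- 2 t)\<close> by the integrands at \<open>Re z + 2\<close> and \<open>Re z - 2\<close>.
\<close>

lemma laplace_transform_entire:
  fixes f :: "real \<Rightarrow> complex"
  assumes f: "\<And>x. integrable lebesgue (\<lambda>t. f t * of_real (exp (x * t)))"
  shows "(\<lambda>z. LINT t|lebesgue. f t * exp (of_real t * z)) holomorphic_on UNIV"
proof -
  let ?F = "\<lambda>z. LINT t|lebesgue. f t * exp (of_real t * z)"
  have fm: "f \<in> borel_measurable lebesgue" using f[of 0] by simp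
  have em: "(\<lambda>t. exp (of_real t * z)) \<in> borel_measurable lebesgue" for z :: complex
    by (intro continuous_imp_lebesgue_measurable continuous_intros)
  have tm: "(\<lambda>t. complex_of_real t) \<in> borel_measurable lebesgue"
    by (intro continuous_imp_lebesgue_measurable continuous_intros)
  have int: "integrable lebesgue (\<lambda>t. f t * exp (of_real t * z))" for z
  proof (rule Bochner_Integration.integrable_bound[OF f[of "Re z"]])
    show "(\<lambda>t. f t * exp (of_real t * z)) \<in> borel_measurable lebesgue"
      by (intro borel_measurable_times fm em)
  qed (simp add: norm_mult mult.commute)
  have "(?F has_field_derivative (LINT t|lebesgue. f t * (of_real t * exp (of_real t * z)))) (at z)" for z
    unfolding has_field_derivative_iff tendsto_at_iff_sequentially o_def
  proof (intro allI impI)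
    fix X :: "nat \<Rightarrow> complex"
    assume X0: "\<forall>i. X i \<in> UNIV - {z}" and X: "X \<longlonglongrightarrow> z"
    have "\<forall>\<^sub>F i in sequentially. dist (X i) z < 1" using X by (rule tendstoD) simp
    then obtain N where N: "\<And>i. i \<ge> N \<Longrightarrow> cmod (X i - z) < 1"
      unfolding eventually_sequentially dist_norm by blast
    \<comment> \<open>dominated convergence wants the bound for every index, so finitely many terms are dropped\<close>
    define Y where "Y = (\<lambda>i. X (i + N))"
    have Y0: "Y i \<noteq> z" and Y1: "cmod (Y i - z) < 1" for i
      using X0 N[of "i + N"] by (auto simp: Y_def)
    have Y: "Y \<longlonglongrightarrow> z" unfolding Y_def using X by (rule LIMSEQ_ignore_initial_segment)
    define s where "s = (\<lambda>i t. f t * ((exp (of_real t * Y i) - exp (of_real t * z)) / (Y i - z)))"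
    have "(\<lambda>i. LINT t|lebesgue. s i t) \<longlonglongrightarrow> (LINT t|lebesgue. f t * (of_real t * exp (of_real t * z)))"
    proof (rule integral_dominated_convergence)
      let ?w = "\<lambda>t. cmod (f t * of_real (exp ((Re z + 2) * t))) + cmod (f t * of_real (exp ((Re z - 2) * t)))"
      show "(\<lambda>t. f t * (of_real t * exp (of_real t * z))) \<in> borel_measurable lebesgue"
        by (intro borel_measurable_times fm em tm)
      show "s i \<in> borel_measurable lebesgue" for i
        unfolding s_def by (intro borel_measurable_times borel_measurable_divide borel_measurable_diff fm em) auto
      show "integrable lebesgue ?w"
        by (intro Bochner_Integration.integrable_add integrable_norm f)
      show "AE t in lebesgue. (\<lambda>i. s i t) \<longlonglongrightarrow> f t * (of_real t * exp (of_real t * z))"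
      proof (intro AE_I2)
        fix t
        have "((\<lambda>z. exp (of_real t * z)) has_field_derivative (of_real t * exp (of_real t * z))) (at z)"
          by (auto intro!: derivative_eq_intros)
        then have "((\<lambda>y. (exp (of_real t * y) - exp (of_real t * z)) / (y - z)) \<longlongrightarrow> of_real t * exp (of_real t * z)) (at z)"
          by (simp add: has_field_derivative_iff)
        then have "(\<lambda>i. (exp (of_real t * Y i) - exp (of_real t * z)) / (Y i - z)) \<longlonglongrightarrow> of_real t * exp (of_real t * z)"
          using Y Y0 unfolding tendsto_at_iff_sequentially o_def by blast
        then show "(\<lambda>i. s i t) \<longlonglongrightarrow> f t * (of_real t * exp (of_real t * z))"
          unfolding s_def by (intro tendsto_mult tendsto_const)
      qed
      show "AE t in lebesgue. norm (s i t) \<le> ?w t" for i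
      proof (intro AE_I2)
        fix t :: real
        define d where "d = Y i - z"
        have d: "d \<noteq> 0" "cmod d < 1" using Y0 Y1 by (auto simp: d_def)
        have "exp (of_real t * Y i) - exp (of_real t * z) = exp (of_real t * z) * (exp (of_real t * d) - 1)"
          by (simp add: d_def algebra_simps flip: exp_add)
        moreover have "cmod (exp (of_real t * d) - 1) \<le> exp (2 * \<bar>t\<bar>) * cmod d"
        proof -
          have "cmod (exp (of_real t * d) - 1) \<le> exp \<bar>Re (of_real t * d)\<bar> * cmod (of_real t * d)"
            using Taylor_exp[of "of_real t * d" 0] by simp
          also have "\<dots> \<le> exp (cmod (of_real t * d)) * cmod (of_real t * d)"
            using abs_Re_le_cmod[of "of_real t * d"] by (intro mult_right_mono) auto
          also have "\<dots> = \<bar>t\<bar> * exp (\<bar>t\<bar> * cmod d) * cmod d" by (simp add: norm_mult)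
          also have "\<dots> \<le> exp \<bar>t\<bar> * exp (\<bar>t\<bar> * 1) * cmod d"
          proof (intro mult_right_mono mult_mono)
            show "\<bar>t\<bar> \<le> exp \<bar>t\<bar>" using exp_ge_add_one_self[of "\<bar>t\<bar>"] by linarith
            show "exp (\<bar>t\<bar> * cmod d) \<le> exp (\<bar>t\<bar> * 1)"
              using d by (simp only: exp_le_cancel_iff) (intro mult_left_mono; simp)
          qed auto
          also have "\<dots> = exp (2 * \<bar>t\<bar>) * cmod d" by (simp flip: exp_add)
          finally show ?thesis .
        qed
        ultimately have "cmod ((exp (of_real t * Y i) - exp (of_real t * z)) / (Y i - z)) \<le> exp (t * Re z) * exp (2 * \<bar>t\<bar>)"
          using d by (simp add: norm_divide norm_mult divide_le_eq flip: d_def)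
        also have "\<dots> \<le> exp ((Re z + 2) * t) + exp ((Re z - 2) * t)"
          by (cases "t \<ge> 0") (auto simp: algebra_simps simp flip: exp_add)
        finally have "cmod (s i t) \<le> cmod (f t) * (exp ((Re z + 2) * t) + exp ((Re z - 2) * t))"
          unfolding s_def norm_mult by (intro mult_left_mono) auto
        then show "norm (s i t) \<le> ?w t" by (simp add: norm_mult algebra_simps)
      qed
    qed
    moreover have "(LINT t|lebesgue. s i t) = (?F (Y i) - ?F z) / (Y i - z)" for i
    proof -
      have "(LINT t|lebesgue. s i t) = (LINT t|lebesgue. (f t * exp (of_real t * Y i) - f t * exp (of_real t * z)) / (Y i - z))"
        by (intro Bochner_Integration.integral_cong) (auto simp: s_def algebra_simps diff_divide_distrib)
      then show ?thesis using int by simp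
    qed
    ultimately have "(\<lambda>i. (?F (X (i + N)) - ?F z) / (X (i + N) - z)) \<longlonglongrightarrow> (LINT t|lebesgue. f t * (of_real t * exp (of_real t * z)))"
      by (simp add: Y_def)
    then show "(\<lambda>i. (?F (X i) - ?F z) / (X i - z)) \<longlonglongrightarrow> (LINT t|lebesgue. f t * (of_real t * exp (of_real t * z)))"
      by (rule LIMSEQ_offset)
  qed
  then show ?thesis by (auto simp: holomorphic_on_def field_differentiable_def)
qed

definition gauss_laplace :: "(real \<Rightarrow> complex) \<Rightarrow> complex \<Rightarrow> complex" where
  "gauss_laplace g z = (LINT t|lebesgue. g t * of_real (exp (- pi * t\<^sup>2)) * exp (of_real t * z))"

text \<open>
  The factor \<open>exp (- \<pi> z\<^sup>2 / 2)\<close> makes the growth bound rotation invariant: without it the transform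
  is of size \<open>exp (\<pi> (Re z)\<^sup>2)\<close>.
\<close>

definition bargmann :: "(real \<Rightarrow> complex) \<Rightarrow> complex \<Rightarrow> complex" where
  "bargmann g z = gauss_laplace g (2 * of_real pi * z) * exp (- of_real pi * z\<^sup>2 / 2)"

lemma integrable_gauss_shift:
  "integrable lebesgue (\<lambda>t. exp (- 2 * pi * (t - x)\<^sup>2))"
  "(LINT t|lebesgue. exp (- 2 * pi * (t - x)\<^sup>2)) = (LINT t|lebesgue. exp (- 2 * pi * t\<^sup>2))"
proof -
  let ?g = "\<lambda>t::real. exp (- 2 * pi * t\<^sup>2)"
  have nd: "normal_density 0 (1 / (2 * sqrt pi)) = (\<lambda>t. sqrt 2 * ?g t)"
  proof
    fix t :: real
    have "(1 / (2 * sqrt pi))\<^sup>2 = 1 / (4 * pi)"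
      by (simp add: power_divide power_mult_distrib)
    moreover have "sqrt (2 * pi * (1 / (4 * pi))) = 1 / sqrt 2"
      by (simp add: real_sqrt_divide)
    moreover have "- (t - 0)\<^sup>2 / (2 * (1 / (4 * pi))) = - 2 * pi * t\<^sup>2"
      by simp
    ultimately show "normal_density 0 (1 / (2 * sqrt pi)) t = sqrt 2 * ?g t"
      unfolding normal_density_def by simp
  qed
  have "integrable lborel (normal_density 0 (1 / (2 * sqrt pi)))"
    by (rule integrable_normal_density) simp
  then have "integrable lborel (\<lambda>t. sqrt 2 * ?g t)" unfolding nd .
  then have g: "integrable lborel ?g" by simp
  have "integrable lborel (\<lambda>t. ?g (- x + 1 * t))"
    using g by (rule lborel_integrable_real_affine) simp
  moreover have "(LINT t|lborel. ?g t) = \<bar>1\<bar> *\<^sub>R (LINT t|lborel. ?g (- x + 1 * t))"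
    by (rule lborel_integral_real_affine) simp
  ultimately show "integrable lebesgue (\<lambda>t. exp (- 2 * pi * (t - x)\<^sup>2))"
    "(LINT t|lebesgue. exp (- 2 * pi * (t - x)\<^sup>2)) = (LINT t|lebesgue. exp (- 2 * pi * t\<^sup>2))"
    by (simp_all add: integrable_completion integral_completion)
qed

text \<open>
  By the arithmetic-geometric mean inequality the integrand is dominated by \<open>exp (\<pi> x\<^sup>2)\<close> times half the sum of \<open>\<bar>g t\<bar>\<^sup>2\<close>
  and a translated Gaussian, whose integral does not depend on \<open>x\<close>.
\<close>

lemma
  fixes x :: real
  assumes g: "g \<in> L2_complex"
  shows gauss_laplace_integrable:
      "integrable lebesgue (\<lambda>t. g t * of_real (exp (- pi * t\<^sup>2)) * of_real (exp (2 * pi * x * t)))"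
    and gauss_laplace_norm_bound:
      "\<exists>C. \<forall>x. (LINT t|lebesgue. cmod (g t * of_real (exp (- pi * t\<^sup>2)) * of_real (exp (2 * pi * x * t)))) \<le> C * exp (pi * x\<^sup>2)"
proof -
  have gm: "g \<in> borel_measurable lebesgue" and g2: "integrable lebesgue (\<lambda>t. (cmod (g t))\<^sup>2)"
    using g by (auto simp: L2_complex_def)
  define N where "N = (LINT t|lebesgue. (cmod (g t))\<^sup>2)"
  define \<gamma> where "\<gamma> = (LINT t|lebesgue. exp (- 2 * pi * t\<^sup>2))"
  let ?f = "\<lambda>x t. g t * of_real (exp (- pi * t\<^sup>2)) * of_real (exp (2 * pi * x * t))"
  let ?b = "\<lambda>x t. exp (pi * x\<^sup>2) * ((cmod (g t))\<^sup>2 + exp (- 2 * pi * (t - x)\<^sup>2)) / 2"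
  have b: "cmod (?f x t) \<le> ?b x t" for x t
  proof -
    have "cmod (?f x t) = exp (pi * x\<^sup>2) * (cmod (g t) * exp (- pi * (t - x)\<^sup>2))"
      by (simp add: norm_mult mult_ac power2_eq_square algebra_simps flip: exp_add)
    also have "cmod (g t) * exp (- pi * (t - x)\<^sup>2) \<le> ((cmod (g t))\<^sup>2 + (exp (- pi * (t - x)\<^sup>2))\<^sup>2) / 2"
      using sum_squares_bound[of "cmod (g t)" "exp (- pi * (t - x)\<^sup>2)"] by simp
    also have "(exp (- pi * (t - x)\<^sup>2))\<^sup>2 = exp (- 2 * pi * (t - x)\<^sup>2)"
      by (simp add: power2_eq_square flip: exp_add)
    finally show ?thesis by simp
  qed
  have bi: "integrable lebesgue (?b x)" for x
    using g2 integrable_gauss_shift(1)[of x] by simp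
  have fm: "?f x \<in> borel_measurable lebesgue" for x
    by (intro borel_measurable_times gm continuous_imp_lebesgue_measurable continuous_intros)
  have fi: "integrable lebesgue (?f x)" for x
    by (rule Bochner_Integration.integrable_bound[OF bi[of x] fm]) (rule AE_I2, rule order_trans[OF b], simp)
  have "(LINT t|lebesgue. cmod (?f x t)) \<le> (LINT t|lebesgue. ?b x t)" for x
    using fi bi b by (intro integral_mono integrable_norm)
  also have "(LINT t|lebesgue. ?b x t) = (N + \<gamma>) / 2 * exp (pi * x\<^sup>2)" for x
    using g2 integrable_gauss_shift[of x] by (simp add: N_def \<gamma>_def)
  finally show "\<exists>C. \<forall>x. (LINT t|lebesgue. cmod (?f x t)) \<le> C * exp (pi * x\<^sup>2)"
    by blast
  show "integrable lebesgue (?f x)" by (rule fi)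
qed

lemma bargmann_entire:
  assumes g: "g \<in> L2_complex"
  shows "bargmann g holomorphic_on UNIV"
proof -
  have "integrable lebesgue (\<lambda>t. (g t * of_real (exp (- pi * t\<^sup>2))) * of_real (exp (x * t)))" for x
    using gauss_laplace_integrable[OF g, of "x / (2 * pi)"] by simp
  then have "gauss_laplace g holomorphic_on UNIV"
    unfolding gauss_laplace_def[abs_def] by (rule laplace_transform_entire)
  moreover have "(\<lambda>z. 2 * of_real pi * z) holomorphic_on UNIV" by (intro holomorphic_intros)
  ultimately have "(\<lambda>z. gauss_laplace g (2 * of_real pi * z)) holomorphic_on UNIV"
    using holomorphic_on_compose_gen[of "\<lambda>z. 2 * of_real pi * z" UNIV "gauss_laplace g" UNIV]
    by (simp add: o_def)
  then show ?thesis
    unfolding bargmann_def[abs_def] by (intro holomorphic_intros) auto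
qed

lemma bargmann_growth:
  assumes g: "g \<in> L2_complex"
  shows "\<exists>C. \<forall>z. cmod (bargmann g z) \<le> C * exp (pi / 2 * (cmod z)\<^sup>2)"
proof -
  obtain C where C: "\<forall>x::real. (LINT t|lebesgue. cmod (g t * of_real (exp (- pi * t\<^sup>2)) * of_real (exp (2 * pi * x * t)))) \<le> C * exp (pi * x\<^sup>2)"
    using gauss_laplace_norm_bound[OF g] by (rule exE)
  have "cmod (bargmann g z) \<le> C * exp (pi / 2 * (cmod z)\<^sup>2)" for z
  proof -
    have "cmod (gauss_laplace g (2 * of_real pi * z))
        \<le> (LINT t|lebesgue. cmod (g t * of_real (exp (- pi * t\<^sup>2)) * exp (of_real t * (2 * of_real pi * z))))"
      unfolding gauss_laplace_def by (rule integral_norm_bound)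
    also have "\<dots> = (LINT t|lebesgue. cmod (g t * of_real (exp (- pi * t\<^sup>2)) * of_real (exp (2 * pi * Re z * t))))"
      by (intro Bochner_Integration.integral_cong) (auto simp: norm_mult mult_ac)
    also have "\<dots> \<le> C * exp (pi * (Re z)\<^sup>2)" by (rule C[rule_format])
    finally have "cmod (bargmann g z) \<le> C * exp (pi * (Re z)\<^sup>2) * cmod (exp (- of_real pi * z\<^sup>2 / 2))"
      unfolding bargmann_def norm_mult by (intro mult_right_mono) auto
    also have "cmod (exp (- of_real pi * z\<^sup>2 / 2)) = exp (- pi * ((Re z)\<^sup>2 - (Im z)\<^sup>2) / 2)"
      by (simp add: power2_eq_square)
    also have "C * exp (pi * (Re z)\<^sup>2) * \<dots> = C * exp (pi / 2 * (cmod z)\<^sup>2)"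
      by (simp only: cmod_power2 mult.assoc flip: exp_add) (simp add: field_simps)
    finally show ?thesis .
  qed
  then show ?thesis by blast
qed

text \<open>
  Expanding \<open>(t - x)\<^sup>2\<close>, the kernel becomes \<open>exp (- \<pi> x\<^sup>2) exp (- \<pi> t\<^sup>2) exp (2 \<pi> t (x - \<i> \<omega>))\<close>, which is why the conjugate of \<open>u\<close> appears.
\<close>

lemma cmod_gabor_eq_bargmann:
  "cmod (gabor g (Re u) (Im u)) = cmod (bargmann g (cnj u)) * exp (- pi / 2 * (cmod u)\<^sup>2)"
proof -
  define x w where "x = Re u" and "w = Im u"
  have "gabor g x w = (LINT t|lebesgue. of_real (exp (- pi * x\<^sup>2)) *
      (g t * of_real (exp (- pi * t\<^sup>2)) * exp (of_real t * (2 * of_real pi * cnj u))))"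
    unfolding gabor_def
  proof (intro Bochner_Integration.integral_cong refl)
    fix t :: real
    have u: "cnj u = of_real x - \<i> * of_real w" by (simp add: x_def w_def complex_eq_iff)
    have "complex_of_real (exp (- pi * (t - x)\<^sup>2)) * exp (- 2 * of_real pi * \<i> * of_real w * of_real t)
        = of_real (exp (- pi * x\<^sup>2)) * (of_real (exp (- pi * t\<^sup>2)) * exp (of_real t * (2 * of_real pi * cnj u)))"
      unfolding u by (simp add: power2_eq_square algebra_simps flip: exp_add exp_of_real)
    then show "g t * complex_of_real (exp (- pi * (t - x)\<^sup>2)) * exp (- 2 * of_real pi * \<i> * of_real w * of_real t)
        = of_real (exp (- pi * x\<^sup>2)) * (g t * of_real (exp (- pi * t\<^sup>2)) * exp (of_real t * (2 * of_real pi * cnj u)))"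
      by (simp only: mult.assoc mult.left_commute)
  qed
  also have "\<dots> = of_real (exp (- pi * x\<^sup>2)) * gauss_laplace g (2 * of_real pi * cnj u)"
    by (simp add: gauss_laplace_def)
  finally have "cmod (gabor g x w) = exp (- pi * x\<^sup>2) * cmod (gauss_laplace g (2 * of_real pi * cnj u))"
    by (simp add: norm_mult)
  moreover have "cmod (bargmann g (cnj u)) = cmod (gauss_laplace g (2 * of_real pi * cnj u)) * exp (- pi * (x\<^sup>2 - w\<^sup>2) / 2)"
    by (simp add: bargmann_def norm_mult power2_eq_square x_def w_def)
  moreover have "exp (- pi * (x\<^sup>2 - w\<^sup>2) / 2) * exp (- pi / 2 * (cmod u)\<^sup>2) = exp (- pi * x\<^sup>2)"
    by (simp only: cmod_power2 x_def w_def flip: exp_add) (simp add: field_simps)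
  ultimately show ?thesis by (simp add: x_def w_def)
qed

text \<open>
  On the imaginary axis the transform is the Fourier transform of the integrable function
  \<open>g t exp (- \<pi> t\<^sup>2)\<close>.
\<close>

lemma bargmann_injective:
  assumes g: "g \<in> L2_complex" and h: "h \<in> L2_complex"
    and eq: "\<And>z. bargmann g z = c * bargmann h z"
  shows "AE t in lebesgue. g t = c * h t"
proof -
  let ?G = "\<lambda>g t. g t * complex_of_real (exp (- pi * t\<^sup>2))"
  have i: "integrable lebesgue (?G g)" if g: "g \<in> L2_complex" for g
    using gauss_laplace_integrable[OF g, of 0] by simp
  have i': "integrable lebesgue (\<lambda>t. ?G g t * iexp (w * t))" if g: "g \<in> L2_complex" for g w
  proof (rule Bochner_Integration.integrable_bound[OF i[OF g]])
    show "(\<lambda>t. ?G g t * iexp (w * t)) \<in> borel_measurable lebesgue"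
      by (intro borel_measurable_times[OF borel_measurable_integrable[OF i[OF g]]] continuous_imp_lebesgue_measurable continuous_intros)
  qed (simp add: norm_mult)
  have L: "gauss_laplace g (\<i> * of_real w) = (LINT t|lebesgue. ?G g t * iexp (w * t))" for g w
    unfolding gauss_laplace_def by (intro Bochner_Integration.integral_cong) (auto simp: mult_ac)
  have eqL: "gauss_laplace g z = c * gauss_laplace h z" for z
    using eq[of "z / (2 * of_real pi)"] by (simp add: bargmann_def)
  have "AE t in lebesgue. ?G g t - c * ?G h t = 0"
  proof (rule fourier_uniqueness)
    show "integrable lebesgue (\<lambda>t. ?G g t - c * ?G h t)" using i g h by simp
    fix w
    have "(LINT t|lebesgue. (?G g t - c * ?G h t) * iexp (w * t)) = (LINT t|lebesgue. ?G g t * iexp (w * t) - c * (?G h t * iexp (w * t)))"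
      by (intro Bochner_Integration.integral_cong) (auto simp: algebra_simps)
    also have "\<dots> = (LINT t|lebesgue. ?G g t * iexp (w * t)) - c * (LINT t|lebesgue. ?G h t * iexp (w * t))"
      by (subst Bochner_Integration.integral_diff)
         (use i'[OF g] i'[OF h] in \<open>auto intro: Bochner_Integration.integrable_mult_right\<close>)
    also have "\<dots> = 0" using eqL[of "\<i> * of_real w"] unfolding L by simp
    finally show "(LINT t|lebesgue. (?G g t - c * ?G h t) * iexp (w * t)) = 0" .
  qed
  then show ?thesis
  proof eventually_elim
    case (elim t)
    then have "(g t - c * h t) * complex_of_real (exp (- pi * t\<^sup>2)) = 0" by (simp add: algebra_simps)
    then show ?case by simp
  qed
qed

lemma gabor_cnj:
  assumes "g \<in> L2_real"
  shows "gabor g x (- w) = cnj (gabor g x w)"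
proof -
  have g: "AE t in lebesgue. g t \<in> \<real>" and gm: "g \<in> borel_measurable lebesgue"
    using assms by (auto simp: L2_real_def L2_complex_def)
  let ?k = "\<lambda>w t. g t * of_real (exp (- pi * (t - x)\<^sup>2)) * exp (- 2 * of_real pi * \<i> * of_real w * of_real t)"
  have km: "?k w \<in> borel_measurable lebesgue" for w
    by (intro borel_measurable_times gm continuous_imp_lebesgue_measurable continuous_intros)
  have "gabor g x (- w) = (LINT t|lebesgue. cnj (?k w t))"
    unfolding gabor_def
  proof (rule integral_cong_AE)
    show "(\<lambda>t. cnj (?k w t)) \<in> borel_measurable lebesgue"
      using measurable_compose[OF km borel_measurable_continuous_onI[OF continuous_on_cnj[OF continuous_on_id]]] by simp
    show "AE t in lebesgue. ?k (- w) t = cnj (?k w t)"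
      using g
    proof eventually_elim
      case (elim t)
      then show ?case by (simp add: Reals_cnj_iff exp_cnj)
    qed
  qed (rule km)
  also have "\<dots> = cnj (gabor g x w)"
    unfolding gabor_def by (rule Bochner_Integration.integral_cnj)
  finally show ?thesis .
qed

lemma gabor_reflect:
  assumes "g \<in> L2_real_even"
  shows "gabor g (- x) (- w) = gabor g x w"
proof -
  have g: "AE t in lebesgue. g (- t) = g t" and gm: "g \<in> borel_measurable lebesgue"
    using assms by (auto simp: L2_real_even_def L2_real_def L2_complex_def)
  let ?k = "\<lambda>x w t. g t * of_real (exp (- pi * (t - x)\<^sup>2)) * exp (- 2 * of_real pi * \<i> * of_real w * of_real t)"
  have km: "?k x w \<in> borel_measurable lebesgue" for x w
    by (intro borel_measurable_times gm continuous_imp_lebesgue_measurable continuous_intros)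
  have lm: "(\<lambda>t::real. - t) \<in> measurable lebesgue lebesgue"
  proof -
    have "(*\<^sub>R) (- 1) = (uminus :: real \<Rightarrow> real)" by (rule ext) simp
    then show ?thesis using lebesgue_measurable_scaling[of "- 1", where ?'a = real] by simp
  qed
  have refl: "distr lebesgue lebesgue uminus = (lebesgue :: real measure)"
    using lebesgue_real_affine[of "- 1" 0] by (simp add: density_1)
  have "gabor g (- x) (- w) = (LINT t|distr lebesgue lebesgue uminus. ?k (- x) (- w) t)"
    by (simp only: refl gabor_def)
  also have "\<dots> = (LINT t|lebesgue. ?k (- x) (- w) (- t))"
    by (rule integral_distr[OF lm km])
  also have "\<dots> = (LINT t|lebesgue. ?k x w t)"
  proof (rule integral_cong_AE)
    show "(\<lambda>t. ?k (- x) (- w) (- t)) \<in> borel_measurable lebesgue"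
      by (rule measurable_compose[OF lm km])
    show "AE t in lebesgue. ?k (- x) (- w) (- t) = ?k x w t"
      using g by eventually_elim (simp add: power2_eq_square algebra_simps)
  qed (rule km)
  finally show ?thesis by (simp add: gabor_def)
qed

section \<open>Perturbed lattices and their densities\<close>

lemma has_uniform_density_Un:
  assumes U: "has_uniform_density U D" and V: "has_uniform_density V E" and "U \<inter> V = {}"
  shows "has_uniform_density (U \<union> V) (D + E)"
proof -
  let ?e = "\<lambda>U D r z. (real (card (U \<inter> cball z r)) - D * measure lebesgue (cball z r)) / r\<^sup>2"
  have fin: "finite (U \<inter> cball z r)" "finite (V \<inter> cball z r)" for z r
    using U V by (auto simp: has_uniform_density_def)
  have card: "card ((U \<union> V) \<inter> cball z r) = card (U \<inter> cball z r) + card (V \<inter> cball z r)" for z r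
    using fin[of z r] \<open>U \<inter> V = {}\<close> by (subst card_Un_disjoint[symmetric]) (auto simp: Int_Un_distrib2)
  have "uniform_limit UNIV (\<lambda>r z. ?e U D r z + ?e V E r z) (\<lambda>z. 0 + 0) at_top"
    using U V unfolding has_uniform_density_def by (intro uniform_limit_add) auto
  moreover have "?e U D r z + ?e V E r z = ?e (U \<union> V) (D + E) r z" for r z
    by (simp add: card add_divide_distrib diff_divide_distrib distrib_right)
  ultimately show ?thesis
    using U V fin by (simp add: has_uniform_density_def Int_Un_distrib2)
qed

text \<open>
  Half-open rectangles, so that the cells belonging to all pairs of integers partition the plane.
\<close>

definition lattice_cell :: "real \<Rightarrow> real \<Rightarrow> complex \<Rightarrow> int \<times> int \<Rightarrow> complex set" where
  "lattice_cell a b c p = {z. Re c + a * fst p \<le> Re z \<and> Re z < Re c + a * (fst p + 1) \<and>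
                              Im c + b * snd p \<le> Im z \<and> Im z < Im c + b * (snd p + 1)}"

lemma lattice_cell_eq_floor:
  fixes a b :: real
  assumes "a > 0" "b > 0"
  shows "z \<in> lattice_cell a b c p \<longleftrightarrow> p = (\<lfloor>(Re z - Re c) / a\<rfloor>, \<lfloor>(Im z - Im c) / b\<rfloor>)"
proof -
  have "n = \<lfloor>(x - u) / s\<rfloor> \<longleftrightarrow> u + s * of_int n \<le> x \<and> x < u + s * (of_int n + 1)"
    if "s > 0" for n and x u s :: real
    using that by (auto simp: eq_commute[of n] floor_eq_iff field_simps)
  then show ?thesis using assms by (cases p) (auto simp: lattice_cell_def)
qed

lemma lattice_cell_measure:
  fixes a b :: real
  assumes "a > 0" "b > 0"
  shows "lattice_cell a b c p \<in> lmeasurable" "measure lebesgue (lattice_cell a b c p) = a * b"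
proof -
  define u where "u = c + Complex (a * fst p) (b * snd p)"
  define v where "v = c + Complex (a * (fst p + 1)) (b * (snd p + 1))"
  have sub: "box u v \<subseteq> lattice_cell a b c p" "lattice_cell a b c p \<subseteq> cbox u v"
    by (auto simp: lattice_cell_def u_def v_def in_box_complex_iff in_cbox_complex_iff)
  have "measure lebesgue (cbox u v) = a * b" "measure lebesgue (box u v) = a * b"
    using assms
    by (auto simp: measure_lborel_cbox_eq measure_lborel_box_eq Basis_complex_def u_def v_def algebra_simps)
  moreover have "lattice_cell a b c p \<in> sets borel"
    unfolding lattice_cell_def by measurable
  then show *: "lattice_cell a b c p \<in> lmeasurable"
    using sub(2) by (metis bounded_cbox bounded_set_imp_lmeasurable bounded_subset sets_completionI_sets sets_lborel)
  ultimately show "measure lebesgue (lattice_cell a b c p) = a * b"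
    using measure_mono_fmeasurable[OF sub(1), of lebesgue] measure_mono_fmeasurable[OF sub(2), of lebesgue]
    by (auto simp: fmeasurableD)
qed

lemma lattice_cell_union_measure:
  fixes a b :: real
  assumes "a > 0" "b > 0" "finite I"
  shows "(\<Union>p\<in>I. lattice_cell a b c p) \<in> lmeasurable"
    and "measure lebesgue (\<Union>p\<in>I. lattice_cell a b c p) = card I * (a * b)"
proof -
  show "(\<Union>p\<in>I. lattice_cell a b c p) \<in> lmeasurable"
    using assms lattice_cell_measure by (intro fmeasurable.finite_UN) auto
  have "pairwise (\<lambda>p q. disjnt (lattice_cell a b c p) (lattice_cell a b c q)) I"
    using lattice_cell_eq_floor[OF assms(1,2)] unfolding pairwise_def disjnt_iff by metis
  then have "measure lebesgue (\<Union>p\<in>I. lattice_cell a b c p) = (\<Sum>p\<in>I. measure lebesgue (lattice_cell a b c p))"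
    using assms lattice_cell_measure by (intro measure_UNION') auto
  then show "measure lebesgue (\<Union>p\<in>I. lattice_cell a b c p) = card I * (a * b)"
    using lattice_cell_measure[OF assms(1,2)] by simp
qed

text \<open>
  Each point is assigned the cell of its lattice point, which stays within the distance \<open>C + a + b\<close> of it. The cells
  of the points counted in a disc of radius \<open>r\<close> are covered by the disc of radius \<open>r + C'\<close> and cover the disc of
  radius \<open>r - C'\<close>; comparing areas gives the count up to an error of order \<open>r\<close>, uniformly in the centre.
\<close>

lemma perturbed_lattice_density:
  fixes w :: "int \<times> int \<Rightarrow> complex"
  assumes ab: "a > 0" "b > 0" and "inj w"
    and w: "\<And>k l. cmod (w (k, l) - (c + Complex (a * of_int k) (b * of_int l))) \<le> C"
  shows "has_uniform_density (range w) (1 / (a * b))"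
proof -
  define C' where "C' = C + a + b"
  have "C \<ge> 0" using order_trans[OF norm_ge_zero w] .
  then have "C' > 0" using ab by (simp add: C'_def)
  have cell: "cmod (y - w p) \<le> C'" if "y \<in> lattice_cell a b c p" for y p
  proof -
    obtain k l where p: "p = (k, l)" by (cases p)
    define q where "q = c + Complex (a * of_int k) (b * of_int l)"
    have "\<bar>Re (y - q)\<bar> \<le> a" "\<bar>Im (y - q)\<bar> \<le> b"
      using that by (auto simp: lattice_cell_def p q_def algebra_simps abs_le_iff)
    then have "cmod (y - q) \<le> a + b" using cmod_le[of "y - q"] by linarith
    moreover have "cmod (w p - q) \<le> C" using w p by (simp add: q_def)
    ultimately show ?thesis
      using norm_triangle_ineq4[of "y - q" "w p - q"] by (simp add: C'_def)
  qed
  define I where "I = (\<lambda>z r. {p. w p \<in> cball z r})"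
  have finI: "finite (I z r)" for z r
  proof -
    define B where "B = cmod z + r + C + cmod c"
    have "I z r \<subseteq> {- \<lceil>B / a\<rceil>..\<lceil>B / a\<rceil>} \<times> {- \<lceil>B / b\<rceil>..\<lceil>B / b\<rceil>}"
    proof
      fix p assume p: "p \<in> I z r"
      obtain k l where kl: "p = (k, l)" by (cases p)
      let ?q = "Complex (a * of_int k) (b * of_int l)"
      have "cmod ?q \<le> cmod (w p - (c + ?q)) + cmod (w p - z) + cmod z + cmod c"
        using norm_triangle_ineq4[of "w p - c" "w p - (c + ?q)"] norm_triangle_ineq4[of "w p" c]
          norm_triangle_ineq2[of "w p" z] by simp
      then have B: "cmod ?q \<le> B"
        using w[of k l] p by (simp add: kl I_def B_def dist_norm norm_minus_commute)
      have "a * \<bar>of_int k\<bar> \<le> B" "b * \<bar>of_int l\<bar> \<le> B"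
        using abs_Re_le_cmod[of ?q] abs_Im_le_cmod[of ?q] B ab by (auto simp: abs_mult)
      then have "\<bar>of_int k\<bar> \<le> B / a" "\<bar>of_int l\<bar> \<le> B / b" using ab by (auto simp: field_simps)
      then have "\<bar>k\<bar> \<le> \<lceil>B / a\<rceil>" "\<bar>l\<bar> \<le> \<lceil>B / b\<rceil>" by linarith+
      then show "p \<in> {- \<lceil>B / a\<rceil>..\<lceil>B / a\<rceil>} \<times> {- \<lceil>B / b\<rceil>..\<lceil>B / b\<rceil>}" by (auto simp: kl)
    qed
    then show ?thesis by (rule finite_subset) auto
  qed
  have img: "range w \<inter> cball z r = w ` I z r" for z r by (auto simp: I_def)
  have card: "card (range w \<inter> cball z r) = card (I z r)" for z r
    unfolding img using \<open>inj w\<close> by (intro card_image) (rule inj_on_subset, auto)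
  have bound: "\<bar>real (card (I z r)) * (a * b) - pi * r\<^sup>2\<bar> \<le> pi * (2 * C' * r + C'\<^sup>2)" if r: "r \<ge> C'" for z r
  proof -
    note U = lattice_cell_union_measure[OF ab finI[of z r], of c]
    have "(\<Union>p\<in>I z r. lattice_cell a b c p) \<subseteq> cball z (r + C')"
    proof clarify
      fix y k l assume y: "(k, l) \<in> I z r" "y \<in> lattice_cell a b c (k, l)"
      then show "y \<in> cball z (r + C')"
        using cell[OF y(2)] norm_triangle_ineq4[of "z - w (k, l)" "y - w (k, l)"]
        by (simp add: I_def dist_norm norm_minus_commute)
    qed
    then have "real (card (I z r)) * (a * b) \<le> measure lebesgue (cball z (r + C'))"
      using U by (metis lmeasurable_cball measure_mono_fmeasurable fmeasurableD)
    also have "\<dots> = pi * (r + C')\<^sup>2"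
      using r \<open>C' > 0\<close> by (simp add: content_cball unit_ball_vol_2)
    finally have 1: "real (card (I z r)) * (a * b) \<le> pi * (r + C')\<^sup>2" .
    have "cball z (r - C') \<subseteq> (\<Union>p\<in>I z r. lattice_cell a b c p)"
    proof
      fix y assume y: "y \<in> cball z (r - C')"
      obtain p where p: "y \<in> lattice_cell a b c p"
        using lattice_cell_eq_floor[OF ab] by blast
      have "p \<in> I z r"
        using cell[OF p] y norm_triangle_ineq[of "z - y" "y - w p"] by (simp add: I_def dist_norm)
      then show "y \<in> (\<Union>p\<in>I z r. lattice_cell a b c p)" using p by blast
    qed
    then have "measure lebesgue (cball z (r - C')) \<le> real (card (I z r)) * (a * b)"
      using U by (metis lmeasurable_cball measure_mono_fmeasurable fmeasurableD)
    moreover have "measure lebesgue (cball z (r - C')) = pi * (r - C')\<^sup>2"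
      using r by (simp add: content_cball unit_ball_vol_2)
    moreover have "pi * (r + C')\<^sup>2 = pi * r\<^sup>2 + pi * (2 * C' * r + C'\<^sup>2)"
      "pi * (r - C')\<^sup>2 \<ge> pi * r\<^sup>2 - pi * (2 * C' * r + C'\<^sup>2)"
      using \<open>C' > 0\<close> by (simp_all add: power2_eq_square algebra_simps)
    ultimately show ?thesis using 1 by linarith
  qed
  have "uniform_limit UNIV (\<lambda>r z. (real (card (range w \<inter> cball z r)) - 1 / (a * b) * measure lebesgue (cball z r)) / r\<^sup>2)
      (\<lambda>z. 0) at_top"
  proof (rule uniform_limitI)
    fix e :: real assume "e > 0"
    have "((\<lambda>r. pi * (2 * C' * r + C'\<^sup>2) / r\<^sup>2) \<longlongrightarrow> 0) at_top"
      by real_asymp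
    then have "\<forall>\<^sub>F r in at_top. pi * (2 * C' * r + C'\<^sup>2) / r\<^sup>2 < e * (a * b)"
      using \<open>e > 0\<close> ab by (intro order_tendstoD) auto
    then show "\<forall>\<^sub>F r in at_top. \<forall>z\<in>UNIV. dist ((real (card (range w \<inter> cball z r)) - 1 / (a * b) * measure lebesgue (cball z r)) / r\<^sup>2) 0 < e"
      using eventually_ge_at_top[of C']
    proof eventually_elim
      case (elim r)
      show ?case
      proof
        fix z :: complex
        have "r > 0" using elim \<open>C' > 0\<close> by linarith
        have "measure lebesgue (cball z r) = pi * r\<^sup>2"
          using \<open>r > 0\<close> by (simp add: content_cball unit_ball_vol_2)
        then have "(real (card (range w \<inter> cball z r)) - 1 / (a * b) * measure lebesgue (cball z r)) / r\<^sup>2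
            = (real (card (I z r)) * (a * b) - pi * r\<^sup>2) / (a * b) / r\<^sup>2"
          using ab by (simp add: card diff_divide_distrib)
        then have "dist ((real (card (range w \<inter> cball z r)) - 1 / (a * b) * measure lebesgue (cball z r)) / r\<^sup>2) 0
            = \<bar>real (card (I z r)) * (a * b) - pi * r\<^sup>2\<bar> / (a * b) / r\<^sup>2"
          using ab by (simp only: dist_real_def) (simp add: abs_mult)
        also have "\<dots> \<le> pi * (2 * C' * r + C'\<^sup>2) / (a * b) / r\<^sup>2"
          using bound[OF elim(2)] ab by (intro divide_right_mono) auto
        also have "\<dots> < e" using elim(1) ab \<open>r > 0\<close> by (simp add: field_simps)
        finally show "dist ((real (card (range w \<inter> cball z r)) - 1 / (a * b) * measure lebesgue (cball z r)) / r\<^sup>2) 0 < e" .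
      qed
    qed
  qed
  then show ?thesis
    using ab finI by (auto simp: has_uniform_density_def img)
qed

definition plane_lattice :: "real \<Rightarrow> real \<Rightarrow> complex \<Rightarrow> complex set" where
  "plane_lattice a b c = range (\<lambda>(k, l). c + Complex (a * of_int k) (b * of_int l))"

lemma plane_latticeI: "z = c + Complex (a * of_int k) (b * of_int l) \<Longrightarrow> z \<in> plane_lattice a b c"
  by (auto simp: plane_lattice_def)

lemma plane_latticeE:
  assumes "z \<in> plane_lattice a b c"
  obtains k l where "z = c + Complex (a * of_int k) (b * of_int l)"
  using assms by (auto simp: plane_lattice_def)

lemma plane_lattice_separated:
  fixes a :: real
  assumes "a > 0" and z: "z \<in> plane_lattice a a c" and w: "w \<in> plane_lattice a a c" and "z \<noteq> w"
  shows "a \<le> cmod (z - w)"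
proof -
  obtain k l where z: "z = c + Complex (a * of_int k) (a * of_int l)" using z by (rule plane_latticeE)
  obtain m n where w: "w = c + Complex (a * of_int m) (a * of_int n)" using w by (rule plane_latticeE)
  have *: "a \<le> \<bar>a * (of_int i - of_int j)\<bar>" if "i \<noteq> j" for i j :: int
  proof -
    have "1 \<le> \<bar>i - j\<bar>" using that by simp
    then have "1 \<le> \<bar>of_int i - of_int j :: real\<bar>" by linarith
    then show ?thesis using \<open>a > 0\<close> by (simp add: abs_mult)
  qed
  have "k \<noteq> m \<or> l \<noteq> n" using \<open>z \<noteq> w\<close> z w by auto
  then show ?thesis
  proof
    assume "k \<noteq> m"
    then show ?thesis
      using *[of k m] abs_Re_le_cmod[of "z - w"] by (simp add: z w algebra_simps)
  next
    assume "l \<noteq> n"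
    then show ?thesis
      using *[of l n] abs_Im_le_cmod[of "z - w"] by (simp add: z w algebra_simps)
  qed
qed

text \<open>
  The Gaussian factor matches the distance required by \<open>entire_phase_retrieval\<close>, and \<open>\<delta>\<close> keeps the
  perturbed points apart when the lattice is fine.
\<close>

definition perturb_size :: "real \<Rightarrow> complex \<Rightarrow> real" where
  "perturb_size \<delta> z = \<delta> * exp (- 8 * (cmod z + 2)\<^sup>2)"

text \<open>
  The three points of the triple around \<open>z\<close>, for \<open>j = 0, 1, 2\<close>. The signs make the construction commute with
  the reflections \<open>cnj\<close> and \<open>uminus\<close>, under which the moduli of Gabor transforms of real and of even real functions are
  invariant.
\<close>

definition perturb :: "real \<Rightarrow> nat \<Rightarrow> complex \<Rightarrow> complex" where
  "perturb \<delta> j z =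
     (if j = 0 then z
      else if j = 1 then z + of_real (perturb_size \<delta> z * sgn (Re z))
      else z + \<i> * of_real (perturb_size \<delta> z * sgn (Im z)))"

lemma perturb_cnj: "perturb \<delta> j (cnj z) = cnj (perturb \<delta> j z)"
  by (simp add: perturb_def perturb_size_def)

lemma perturb_uminus: "perturb \<delta> j (- z) = - perturb \<delta> j z"
  by (simp add: perturb_def perturb_size_def)

lemma perturb_size_bound:
  assumes "\<delta> > 0"
  shows "0 < perturb_size \<delta> z" "perturb_size \<delta> z \<le> \<delta>"
  using assms by (auto simp: perturb_size_def)

lemma abs_sgn_le_1: "\<bar>sgn (x::real)\<bar> \<le> 1"
  by (simp add: sgn_if)

lemma perturb_close:
  assumes "\<delta> > 0"
  shows "cmod (perturb \<delta> j z - z) \<le> \<delta>"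
proof -
  have "\<bar>perturb_size \<delta> z * sgn x\<bar> \<le> \<delta>" for x :: real
    using perturb_size_bound[OF assms, of z] mult_mono[OF perturb_size_bound(2)[OF assms, of z] abs_sgn_le_1[of x]] assms
    by (simp add: abs_mult)
  then show ?thesis
    using assms unfolding perturb_def by (simp add: norm_mult del: of_real_mult)
qed

text \<open>
  Points near different lattice points are too far apart to coincide, and around the same point the three
  offsets are zero, a nonzero real and a nonzero imaginary number.
\<close>

lemma perturb_inj:
  assumes \<delta>: "0 < \<delta>" "4 * \<delta> \<le> a" and z: "z \<in> plane_lattice a a c" and w: "w \<in> plane_lattice a a c"
    and nz: "Re z \<noteq> 0" "Im z \<noteq> 0" and ij: "i < 3" "j < 3" and eq: "perturb \<delta> i z = perturb \<delta> j w"
  shows "z = w \<and> i = j"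
proof -
  have "cmod (z - w) \<le> 2 * \<delta>"
    using perturb_close[OF \<delta>(1), of i z] perturb_close[OF \<delta>(1), of j w] eq
      norm_triangle_ineq4[of "perturb \<delta> j w - w" "perturb \<delta> i z - z"] by simp
  then have "z = w"
    using plane_lattice_separated[OF _ z w] \<delta> by fastforce
  have "perturb_size \<delta> z * sgn (Re z) \<noteq> 0" "perturb_size \<delta> z * sgn (Im z) \<noteq> 0"
    using nz perturb_size_bound(1)[OF \<delta>(1), of z] by (auto simp: sgn_if)
  moreover have "perturb \<delta> i z = perturb \<delta> j z" using eq \<open>z = w\<close> by simp
  ultimately have "i = j"
    using ij unfolding perturb_def
    by (cases "i = 0"; cases "i = 1"; cases "j = 0"; cases "j = 1") (auto simp: complex_eq_iff)
  then show ?thesis using \<open>z = w\<close> by simp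
qed

lemma perturbed_family_density:
  assumes ab: "a > 0" "b > 0" and \<delta>: "0 < \<delta>" "4 * \<delta> \<le> \<alpha>"
    and sub: "\<And>j. j < 3 \<Longrightarrow> plane_lattice a b (c j) \<subseteq> plane_lattice \<alpha> \<alpha> c'"
    and nz: "\<And>z. z \<in> plane_lattice \<alpha> \<alpha> c' \<Longrightarrow> Re z \<noteq> 0 \<and> Im z \<noteq> 0"
  shows "has_uniform_density (\<Union>j<3. perturb \<delta> j ` plane_lattice a b (c j)) (3 / (a * b))"
proof -
  have inj: "z = w \<and> i = j"
    if "i < 3" "j < 3" "z \<in> plane_lattice a b (c i)" "w \<in> plane_lattice a b (c j)" "perturb \<delta> i z = perturb \<delta> j w" for i j z w
    using perturb_inj[OF \<delta>, of z c' w i j] sub nz that by blast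
  have dens: "has_uniform_density (perturb \<delta> j ` plane_lattice a b (c j)) (1 / (a * b))" if j: "j < 3" for j
  proof -
    let ?w = "\<lambda>(k, l). perturb \<delta> j (c j + Complex (a * of_int k) (b * of_int l))"
    have "has_uniform_density (range ?w) (1 / (a * b))"
    proof (rule perturbed_lattice_density[OF ab])
      show "inj ?w"
      proof (rule injI)
        fix p q assume "?w p = ?w q"
        then have "c j + Complex (a * of_int (fst p)) (b * of_int (snd p)) = c j + Complex (a * of_int (fst q)) (b * of_int (snd q))"
          using inj[OF j j] plane_latticeI by (force simp: case_prod_beta)
        then show "p = q" using ab by (auto simp: prod_eq_iff)
      qed
      show "cmod (?w (k, l) - (c j + Complex (a * of_int k) (b * of_int l))) \<le> \<delta>" for k l
        using perturb_close[OF \<delta>(1)] by simp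
    qed
    moreover have "range ?w = perturb \<delta> j ` plane_lattice a b (c j)"
      by (simp add: plane_lattice_def image_image case_prod_beta)
    ultimately show ?thesis by simp
  qed
  have disj: "perturb \<delta> i ` plane_lattice a b (c i) \<inter> perturb \<delta> j ` plane_lattice a b (c j) = {}"
    if "i < 3" "j < 3" "i \<noteq> j" for i j
    using inj that by blast
  let ?V = "\<lambda>j. perturb \<delta> j ` plane_lattice a b (c j)"
  have "has_uniform_density ((?V 0 \<union> ?V 1) \<union> ?V 2) ((1 / (a * b) + 1 / (a * b)) + 1 / (a * b))"
    using disj[of 0 1] disj[of 0 2] disj[of 1 2]
    by (intro has_uniform_density_Un dens) auto
  moreover have "(\<Union>j<3. ?V j) = (?V 0 \<union> ?V 1) \<union> ?V 2"
    by (auto simp: eval_nat_numeral less_Suc_eq)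
  ultimately show ?thesis by simp
qed

section \<open>Uniqueness sets for the Gabor transform\<close>

lemma plane_lattice_cnj_iff: "cnj z \<in> plane_lattice a b c \<longleftrightarrow> z \<in> plane_lattice a b (cnj c)"
proof -
  have *: "cnj z \<in> plane_lattice a b (cnj c)" if "z \<in> plane_lattice a b c" for z c
  proof -
    obtain k l where "z = c + Complex (a * of_int k) (b * of_int l)" using \<open>z \<in> _\<close> by (rule plane_latticeE)
    then have "cnj z = cnj c + Complex (a * of_int k) (b * of_int (- l))"
      by (simp add: complex_eq_iff)
    then show ?thesis by (rule plane_latticeI)
  qed
  show ?thesis using *[of z "cnj c"] *[of "cnj z" c] by auto
qed

lemma plane_lattice_uminus_iff: "- z \<in> plane_lattice a b c \<longleftrightarrow> z \<in> plane_lattice a b (- c)"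
proof -
  have *: "- z \<in> plane_lattice a b (- c)" if "z \<in> plane_lattice a b c" for z c
  proof -
    obtain k l where "z = c + Complex (a * of_int k) (b * of_int l)" using \<open>z \<in> _\<close> by (rule plane_latticeE)
    then have "- z = - c + Complex (a * of_int (- k)) (b * of_int (- l))"
      by (simp add: complex_eq_iff)
    then show ?thesis by (rule plane_latticeI)
  qed
  show ?thesis using *[of z "- c"] *[of "- z" c] by auto
qed

text \<open>
  Shifting by half a period keeps the lattice off the coordinate axes, where the reflections have fixed points.
\<close>

definition lattice_center :: "real \<Rightarrow> complex" where
  "lattice_center \<alpha> = Complex (\<alpha> / 2) (\<alpha> / 2)"

definition full_lattice :: "real \<Rightarrow> complex set" where
  "full_lattice \<alpha> = plane_lattice \<alpha> \<alpha> (lattice_center \<alpha>)"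

definition half_lattice :: "real \<Rightarrow> complex set" where
  "half_lattice \<alpha> = plane_lattice \<alpha> (2 * \<alpha>) (lattice_center \<alpha>)"

definition quarter_lattice :: "real \<Rightarrow> complex set" where
  "quarter_lattice \<alpha> = plane_lattice (2 * \<alpha>) (2 * \<alpha>) (lattice_center \<alpha>)"

lemma full_nonzero:
  assumes \<alpha>: "\<alpha> > 0" and "z \<in> full_lattice \<alpha>"
  shows "Re z \<noteq> 0 \<and> Im z \<noteq> 0"
proof -
  from assms(2) obtain k l where z: "z = lattice_center \<alpha> + Complex (\<alpha> * of_int k) (\<alpha> * of_int l)"
    unfolding full_lattice_def by (rule plane_latticeE)
  have "\<alpha> / 2 + \<alpha> * of_int n \<noteq> 0" for n
  proof
    assume "\<alpha> / 2 + \<alpha> * of_int n = 0"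
    then have "\<alpha> * of_int (2 * n + 1) = 0" by (simp add: algebra_simps)
    then have "2 * n + 1 = 0" using \<alpha> by (simp only: mult_eq_0_iff of_int_eq_0_iff) simp
    then show False by presburger
  qed
  then show ?thesis by (simp add: z lattice_center_def)
qed

lemma full_cnj: "z \<in> full_lattice \<alpha> \<Longrightarrow> cnj z \<in> full_lattice \<alpha>"
proof -
  assume "z \<in> full_lattice \<alpha>"
  then obtain k l where "z = lattice_center \<alpha> + Complex (\<alpha> * of_int k) (\<alpha> * of_int l)"
    unfolding full_lattice_def by (rule plane_latticeE)
  then have "cnj z = lattice_center \<alpha> + Complex (\<alpha> * of_int k) (\<alpha> * of_int (- l - 1))"
    by (simp add: complex_eq_iff lattice_center_def algebra_simps)
  then show ?thesis unfolding full_lattice_def by (rule plane_latticeI)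
qed

lemma full_uminus: "z \<in> full_lattice \<alpha> \<Longrightarrow> - z \<in> full_lattice \<alpha>"
proof -
  assume "z \<in> full_lattice \<alpha>"
  then obtain k l where "z = lattice_center \<alpha> + Complex (\<alpha> * of_int k) (\<alpha> * of_int l)"
    unfolding full_lattice_def by (rule plane_latticeE)
  then have "- z = lattice_center \<alpha> + Complex (\<alpha> * of_int (- k - 1)) (\<alpha> * of_int (- l - 1))"
    by (simp add: complex_eq_iff lattice_center_def algebra_simps)
  then show ?thesis unfolding full_lattice_def by (rule plane_latticeI)
qed

lemma half_subset_full: "half_lattice \<alpha> \<subseteq> full_lattice \<alpha>"
proof
  fix z assume "z \<in> half_lattice \<alpha>"
  then obtain k l where "z = lattice_center \<alpha> + Complex (\<alpha> * of_int k) (2 * \<alpha> * of_int l)"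
    unfolding half_lattice_def by (rule plane_latticeE)
  then have "z = lattice_center \<alpha> + Complex (\<alpha> * of_int k) (\<alpha> * of_int (2 * l))" by simp
  then show "z \<in> full_lattice \<alpha>" unfolding full_lattice_def by (rule plane_latticeI)
qed

lemma quarter_subset_full: "quarter_lattice \<alpha> \<subseteq> full_lattice \<alpha>"
proof
  fix z assume "z \<in> quarter_lattice \<alpha>"
  then obtain k l where "z = lattice_center \<alpha> + Complex (2 * \<alpha> * of_int k) (2 * \<alpha> * of_int l)"
    unfolding quarter_lattice_def by (rule plane_latticeE)
  then have "z = lattice_center \<alpha> + Complex (\<alpha> * of_int (2 * k)) (\<alpha> * of_int (2 * l))" by simp
  then show "z \<in> full_lattice \<alpha>" unfolding full_lattice_def by (rule plane_latticeI)
qed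

text \<open>
  Conjugation maps the row with index \<open>l\<close> to the row with index \<open>- l - 1\<close>, which has the other parity.
\<close>

lemma full_cases_half: "z \<in> full_lattice \<alpha> \<Longrightarrow> z \<in> half_lattice \<alpha> \<or> cnj z \<in> half_lattice \<alpha>"
proof -
  assume "z \<in> full_lattice \<alpha>"
  then obtain k l where z: "z = lattice_center \<alpha> + Complex (\<alpha> * of_int k) (\<alpha> * of_int l)"
    unfolding full_lattice_def by (rule plane_latticeE)
  show ?thesis
  proof (cases "even l")
    case True
    then obtain m where "l = 2 * m" by (rule evenE)
    then have "z = lattice_center \<alpha> + Complex (\<alpha> * of_int k) (2 * \<alpha> * of_int m)" using z by simp
    then show ?thesis unfolding half_lattice_def by (blast intro: plane_latticeI)
  next
    case False
    then obtain m where "l = 2 * m + 1" by (rule oddE)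
    then have "cnj z = lattice_center \<alpha> + Complex (\<alpha> * of_int k) (2 * \<alpha> * of_int (- m - 1))"
      using z by (simp add: complex_eq_iff lattice_center_def algebra_simps)
    then show ?thesis unfolding half_lattice_def by (blast intro: plane_latticeI)
  qed
qed

text \<open>
  The reflection \<open>z \<mapsto> - cnj z\<close> changes the parity of the column in the same way.
\<close>

lemma half_cases_quarter: "z \<in> half_lattice \<alpha> \<Longrightarrow> z \<in> quarter_lattice \<alpha> \<or> - cnj z \<in> quarter_lattice \<alpha>"
proof -
  assume "z \<in> half_lattice \<alpha>"
  then obtain k l where z: "z = lattice_center \<alpha> + Complex (\<alpha> * of_int k) (2 * \<alpha> * of_int l)"
    unfolding half_lattice_def by (rule plane_latticeE)
  show ?thesis
  proof (cases "even k")
    case True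
    then obtain m where "k = 2 * m" by (rule evenE)
    then have "z = lattice_center \<alpha> + Complex (2 * \<alpha> * of_int m) (2 * \<alpha> * of_int l)" using z by simp
    then show ?thesis unfolding quarter_lattice_def by (blast intro: plane_latticeI)
  next
    case False
    then obtain m where "k = 2 * m + 1" by (rule oddE)
    then have "- cnj z = lattice_center \<alpha> + Complex (2 * \<alpha> * of_int (- m - 1)) (2 * \<alpha> * of_int l)"
      using z by (simp add: complex_eq_iff lattice_center_def algebra_simps)
    then show ?thesis unfolding quarter_lattice_def by (blast intro: plane_latticeI)
  qed
qed

lemma quarter_reflections_disjoint:
  assumes \<alpha>: "\<alpha> > 0" and "z \<in> quarter_lattice \<alpha>"
  shows "cnj z \<notin> quarter_lattice \<alpha>" "- z \<notin> quarter_lattice \<alpha>" "- cnj z \<notin> quarter_lattice \<alpha>"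
proof -
  obtain k l where z: "z = lattice_center \<alpha> + Complex (2 * \<alpha> * of_int k) (2 * \<alpha> * of_int l)"
    using assms(2) unfolding quarter_lattice_def by (rule plane_latticeE)
  have parity: "- (\<alpha> / 2 + 2 * \<alpha> * of_int m) \<noteq> \<alpha> / 2 + 2 * \<alpha> * of_int n" for m n
  proof
    assume "- (\<alpha> / 2 + 2 * \<alpha> * of_int m) = \<alpha> / 2 + 2 * \<alpha> * of_int n"
    then have "\<alpha> * of_int (2 * (m + n) + 1) = 0" by (simp add: algebra_simps)
    then have "2 * (m + n) + 1 = 0" using \<alpha> by (simp only: mult_eq_0_iff of_int_eq_0_iff) simp
    then show False by presburger
  qed
  have coords: "\<exists>m n. Re w = \<alpha> / 2 + 2 * \<alpha> * of_int m \<and> Im w = \<alpha> / 2 + 2 * \<alpha> * of_int n" if "w \<in> quarter_lattice \<alpha>" for w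
  proof -
    obtain m n where w: "w = lattice_center \<alpha> + Complex (2 * \<alpha> * of_int m) (2 * \<alpha> * of_int n)"
      using \<open>w \<in> quarter_lattice \<alpha>\<close> unfolding quarter_lattice_def by (rule plane_latticeE)
    show ?thesis by (intro exI[of _ m] exI[of _ n]) (simp add: w lattice_center_def)
  qed
  have re: "Re z = \<alpha> / 2 + 2 * \<alpha> * of_int k" "Im z = \<alpha> / 2 + 2 * \<alpha> * of_int l"
    by (simp_all add: z lattice_center_def)
  show "cnj z \<notin> quarter_lattice \<alpha>" using coords[of "cnj z"] parity[of l] re by auto
  show "- z \<notin> quarter_lattice \<alpha>" using coords[of "- z"] parity[of k] re by auto
  show "- cnj z \<notin> quarter_lattice \<alpha>" using coords[of "- cnj z"] parity[of k] re by auto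
qed

text \<open>
  The Bargmann transform is evaluated at \<open>cnj u\<close>. As lattice and perturbation are
  invariant under conjugation, the points at which the moduli of the entire functions agree form the same set.
\<close>

lemma gabor_phase_retrieval_perturbed_lattice:
  assumes \<alpha>: "\<alpha> > 0" and density: "1 / (\<alpha> * \<alpha>) > 4" and \<delta>: "0 < \<delta>" "\<delta> \<le> 1"
    and g: "g \<in> L2_complex" and h: "h \<in> L2_complex"
    and eq: "\<And>z j. z \<in> full_lattice \<alpha> \<Longrightarrow> j < 3 \<Longrightarrow>
       cmod (gabor g (Re (perturb \<delta> j z)) (Im (perturb \<delta> j z))) = cmod (gabor h (Re (perturb \<delta> j z)) (Im (perturb \<delta> j z)))"
  shows "\<exists>\<tau>. cmod \<tau> = 1 \<and> (AE t in lebesgue. g t = \<tau> * h t)"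
proof -
  let ?\<Lambda> = "full_lattice \<alpha>"
  obtain C1 where C1: "\<And>z. cmod (bargmann g z) \<le> C1 * exp (pi / 2 * (cmod z)\<^sup>2)"
    using bargmann_growth[OF g] by blast
  obtain C2 where C2: "\<And>z. cmod (bargmann h z) \<le> C2 * exp (pi / 2 * (cmod z)\<^sup>2)"
    using bargmann_growth[OF h] by blast
  have inj: "inj (\<lambda>(k, l). lattice_center \<alpha> + Complex (\<alpha> * of_int k) (\<alpha> * of_int l))"
    using \<open>\<alpha> > 0\<close> by (auto simp: inj_on_def)
  have dens: "has_uniform_density ?\<Lambda> (1 / (\<alpha> * \<alpha>))"
    unfolding full_lattice_def plane_lattice_def
    by (rule perturbed_lattice_density[where c = "lattice_center \<alpha>" and C = 0, OF \<open>\<alpha> > 0\<close> \<open>\<alpha> > 0\<close> inj]) simp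
  have beq: "cmod (bargmann g (perturb \<delta> j z)) = cmod (bargmann h (perturb \<delta> j z))" if "z \<in> ?\<Lambda>" "j < 3" for j z
    using eq[OF full_cnj[OF that(1)] that(2)] unfolding cmod_gabor_eq_bargmann perturb_cnj by simp
  have size: "\<bar>perturb_size \<delta> z * sgn x\<bar> \<le> exp (- 8 * (cmod z + 2)\<^sup>2)" "x \<noteq> 0 \<Longrightarrow> perturb_size \<delta> z * sgn x \<noteq> 0" for z and x :: real
  proof -
    have "\<bar>perturb_size \<delta> z * sgn x\<bar> \<le> \<bar>perturb_size \<delta> z\<bar> * 1"
      unfolding abs_mult by (intro mult_left_mono abs_sgn_le_1) auto
    also have "\<dots> \<le> exp (- 8 * (cmod z + 2)\<^sup>2)" using \<delta> by (simp add: perturb_size_def abs_mult)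
    finally show "\<bar>perturb_size \<delta> z * sgn x\<bar> \<le> exp (- 8 * (cmod z + 2)\<^sup>2)" .
    show "x \<noteq> 0 \<Longrightarrow> perturb_size \<delta> z * sgn x \<noteq> 0"
      using perturb_size_bound(1)[OF \<delta>(1), of z] by (auto simp: sgn_if)
  qed
  have "\<exists>\<tau>. cmod \<tau> = 1 \<and> (\<forall>z. bargmann g z = \<tau> * bargmann h z)"
  proof (rule entire_phase_retrieval[of "bargmann g" "bargmann h" "max C1 C2" ?\<Lambda> "1 / (\<alpha> * \<alpha>)" \<alpha>
        "\<lambda>z. perturb_size \<delta> z * sgn (Re z)" "\<lambda>z. perturb_size \<delta> z * sgn (Im z)"])
    show "bargmann g holomorphic_on UNIV" by (rule bargmann_entire[OF g])
    show "bargmann h holomorphic_on UNIV" by (rule bargmann_entire[OF h])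
    show "cmod (bargmann g z) \<le> max C1 C2 * exp (pi / 2 * (cmod z)\<^sup>2)" for z
      by (rule order_trans[OF C1]) (intro mult_right_mono, auto)
    show "cmod (bargmann h z) \<le> max C1 C2 * exp (pi / 2 * (cmod z)\<^sup>2)" for z
      by (rule order_trans[OF C2]) (intro mult_right_mono, auto)
    show "\<alpha> \<le> cmod (z - w)" if "z \<in> ?\<Lambda>" "w \<in> ?\<Lambda>" "z \<noteq> w" for z w
      using plane_lattice_separated[OF \<alpha>] that unfolding full_lattice_def by blast
    show "perturb_size \<delta> z * sgn (Re z) \<noteq> 0 \<and> \<bar>perturb_size \<delta> z * sgn (Re z)\<bar> \<le> exp (- 8 * (cmod z + 2)\<^sup>2)" if "z \<in> ?\<Lambda>" for z
      using size full_nonzero[OF \<alpha> that] by blast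
    show "perturb_size \<delta> z * sgn (Im z) \<noteq> 0 \<and> \<bar>perturb_size \<delta> z * sgn (Im z)\<bar> \<le> exp (- 8 * (cmod z + 2)\<^sup>2)" if "z \<in> ?\<Lambda>" for z
      using size full_nonzero[OF \<alpha> that] by blast
    show "cmod (bargmann g z) = cmod (bargmann h z)" if "z \<in> ?\<Lambda>" for z
      using beq[OF that, of 0] by (simp add: perturb_def)
    show "cmod (bargmann g (z + of_real (perturb_size \<delta> z * sgn (Re z)))) = cmod (bargmann h (z + of_real (perturb_size \<delta> z * sgn (Re z))))" if "z \<in> ?\<Lambda>" for z
      using beq[OF that, of 1] by (simp add: perturb_def)
    show "cmod (bargmann g (z + \<i> * of_real (perturb_size \<delta> z * sgn (Im z)))) = cmod (bargmann h (z + \<i> * of_real (perturb_size \<delta> z * sgn (Im z))))" if "z \<in> ?\<Lambda>" for z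
      using beq[OF that, of 2] by (simp add: perturb_def)
    show "has_uniform_density ?\<Lambda> (1 / (\<alpha> * \<alpha>))" "1 / (\<alpha> * \<alpha>) > 4" "\<alpha> > 0" by fact+
    show "\<exists>\<tau>. cmod \<tau> = 1 \<and> (\<forall>z. bargmann g z = \<tau> * bargmann h z)"
      if "cmod \<tau> = 1" "\<And>z. bargmann g z = \<tau> * bargmann h z" for \<tau>
      using that by blast
  qed
  then obtain \<tau> where \<tau>: "cmod \<tau> = 1" "\<And>z. bargmann g z = \<tau> * bargmann h z" by blast
  show ?thesis using bargmann_injective[OF g h \<tau>(2)] \<tau>(1) by blast
qed

text \<open>
  The lattice has density \<open>1 / \<alpha>\<^sup>2 = d / 3 > 4\<close>.
\<close>

theorem exists_uniqueness_set_L2_complex: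
  assumes "d > 12"
  shows "\<exists>U. has_uniform_density U d \<and> gabor_uniqueness_set U L2_complex"
proof -
  define \<alpha> where "\<alpha> = sqrt (3 / d)"
  define \<delta> where "\<delta> = min 1 (\<alpha> / 4)"
  have \<alpha>: "\<alpha> > 0" "\<alpha> * \<alpha> = 3 / d" using assms by (auto simp: \<alpha>_def)
  have \<delta>: "0 < \<delta>" "\<delta> \<le> 1" "4 * \<delta> \<le> \<alpha>" using \<alpha>(1) by (auto simp: \<delta>_def)
  let ?U = "\<Union>j<3. perturb \<delta> j ` full_lattice \<alpha>"
  have "has_uniform_density ?U (3 / (\<alpha> * \<alpha>))"
    unfolding full_lattice_def
    by (rule perturbed_family_density[OF \<alpha>(1) \<alpha>(1) \<delta>(1,3) order_refl])
       (use full_nonzero[OF \<alpha>(1)] in \<open>simp add: full_lattice_def\<close>)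
  then have "has_uniform_density ?U d" using assms by (simp add: \<alpha>(2))
  moreover have "gabor_uniqueness_set ?U L2_complex"
    unfolding gabor_uniqueness_set_def
  proof (intro ballI impI)
    fix g h assume "g \<in> L2_complex" "h \<in> L2_complex"
      and eq: "\<forall>u\<in>?U. cmod (gabor g (Re u) (Im u)) = cmod (gabor h (Re u) (Im u))"
    show "\<exists>\<tau>. cmod \<tau> = 1 \<and> (AE t in lebesgue. g t = \<tau> * h t)"
    proof (rule gabor_phase_retrieval_perturbed_lattice[OF \<alpha>(1) _ \<delta>(1,2)])
      show "1 / (\<alpha> * \<alpha>) > 4" using assms by (simp add: \<alpha>(2) field_simps)
      show "g \<in> L2_complex" "h \<in> L2_complex" by fact+
      show "cmod (gabor g (Re (perturb \<delta> j z)) (Im (perturb \<delta> j z)))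
          = cmod (gabor h (Re (perturb \<delta> j z)) (Im (perturb \<delta> j z)))"
        if "z \<in> full_lattice \<alpha>" "j < 3" for z j
        using eq that by blast
    qed
  qed
  ultimately show ?thesis by blast
qed

text \<open>
  Every point of the full lattice, of density \<open>1 / \<alpha>\<^sup>2 = 2 d / 3 > 4\<close>, is in the sublattice of index two up to conjugation,
  which does not change the modulus of the Gabor transform of a real function.
\<close>

theorem exists_uniqueness_set_L2_real:
  assumes "d > 6"
  shows "\<exists>U. has_uniform_density U d \<and> gabor_uniqueness_set U L2_real"
proof -
  define \<alpha> where "\<alpha> = sqrt (3 / (2 * d))"
  define \<delta> where "\<delta> = min 1 (\<alpha> / 4)"
  have \<alpha>: "\<alpha> > 0" "\<alpha> * \<alpha> = 3 / (2 * d)" using assms by (auto simp: \<alpha>_def)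
  have \<delta>: "0 < \<delta>" "\<delta> \<le> 1" "4 * \<delta> \<le> \<alpha>" using \<alpha>(1) by (auto simp: \<delta>_def)
  let ?U = "\<Union>j<3. perturb \<delta> j ` half_lattice \<alpha>"
  have "has_uniform_density ?U (3 / (\<alpha> * (2 * \<alpha>)))"
    unfolding half_lattice_def
    by (rule perturbed_family_density[OF \<alpha>(1) _ \<delta>(1,3), where c' = "lattice_center \<alpha>"])
       (use \<alpha>(1) full_nonzero[OF \<alpha>(1)] half_subset_full in \<open>simp_all add: full_lattice_def half_lattice_def\<close>)
  moreover have "3 / (\<alpha> * (2 * \<alpha>)) = d"
    using assms \<alpha>(2) by (simp add: mult.left_commute[of \<alpha>])
  ultimately have "has_uniform_density ?U d" by simp
  moreover have "gabor_uniqueness_set ?U L2_real"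
    unfolding gabor_uniqueness_set_def
  proof (intro ballI impI)
    fix g h assume gh: "g \<in> L2_real" "h \<in> L2_real"
      and eq: "\<forall>u\<in>?U. cmod (gabor g (Re u) (Im u)) = cmod (gabor h (Re u) (Im u))"
    show "\<exists>\<tau>. cmod \<tau> = 1 \<and> (AE t in lebesgue. g t = \<tau> * h t)"
    proof (rule gabor_phase_retrieval_perturbed_lattice[OF \<alpha>(1) _ \<delta>(1,2)])
      show "1 / (\<alpha> * \<alpha>) > 4" using assms by (simp add: \<alpha>(2) field_simps)
      show "g \<in> L2_complex" "h \<in> L2_complex" using gh by (auto simp: L2_real_def)
      fix z j assume zj: "z \<in> full_lattice \<alpha>" "j < (3::nat)"
      let ?u = "perturb \<delta> j z"
      have "cmod (gabor g (Re w) (Im w)) = cmod (gabor h (Re w) (Im w))"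
        if "w = ?u \<or> w = cnj ?u" "w \<in> ?U" for w using eq that by blast
      moreover have "?u \<in> ?U \<or> cnj ?u \<in> ?U"
        using full_cases_half[OF zj(1)] zj(2) by (auto simp flip: perturb_cnj)
      ultimately show "cmod (gabor g (Re ?u) (Im ?u)) = cmod (gabor h (Re ?u) (Im ?u))"
        using gabor_cnj[OF gh(1), of "Re ?u" "Im ?u"] gabor_cnj[OF gh(2), of "Re ?u" "Im ?u"]
        by (metis complex_cnj complex_mod_cnj complex_surj complex.sel)
    qed
  qed
  ultimately show ?thesis by blast
qed

lemma separated_setI:
  assumes "s > 0" "\<And>u v. u \<in> U \<Longrightarrow> v \<in> U \<Longrightarrow> u \<noteq> v \<Longrightarrow> s \<le> cmod (u - v)"
  shows "separated_set U"
proof -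
  have "ereal s \<le> (INF (u, v) \<in> {(u, v). u \<in> U \<and> v \<in> U \<and> u \<noteq> v}. ereal (cmod (u - v)))"
    using assms by (intro INF_greatest) auto
  moreover have "0 < ereal s" using \<open>s > 0\<close> by simp
  ultimately show ?thesis
    unfolding separated_set_def by (rule less_le_trans[rotated])
qed

text \<open>
  Here \<open>1 / \<alpha>\<^sup>2 = 4 d / 3 > 4\<close>. The sublattice of index four meets every orbit under the reflections
  in one point \<open>z\<close>. The three points of its triple are used at \<open>z\<close>, \<open>cnj z\<close> and \<open>- z\<close> respectively instead of
  all at \<open>z\<close>; for even real functions this carries the same information, and no two points lie
  close together.
\<close>

theorem exists_separated_uniqueness_set_L2_real_even:
  assumes "d > 3"
  shows "\<exists>U. has_uniform_density U d \<and> gabor_uniqueness_set U L2_real_even \<and> separated_set U"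
proof -
  define \<alpha> where "\<alpha> = sqrt (3 / (4 * d))"
  define \<delta> where "\<delta> = min 1 (\<alpha> / 4)"
  have \<alpha>: "\<alpha> > 0" "\<alpha> * \<alpha> = 3 / (4 * d)" using assms by (auto simp: \<alpha>_def)
  have \<delta>: "0 < \<delta>" "\<delta> \<le> 1" "4 * \<delta> \<le> \<alpha>" using \<alpha>(1) by (auto simp: \<delta>_def)
  define c where "c = (\<lambda>j. if j = 0 then lattice_center \<alpha> else if j = (1::nat) then cnj (lattice_center \<alpha>) else - lattice_center \<alpha>)"
  define L where "L = (\<lambda>j. plane_lattice (2 * \<alpha>) (2 * \<alpha>) (c j))"
  have L: "z \<in> L 0 \<longleftrightarrow> z \<in> quarter_lattice \<alpha>" "z \<in> L 1 \<longleftrightarrow> cnj z \<in> quarter_lattice \<alpha>" "z \<in> L 2 \<longleftrightarrow> - z \<in> quarter_lattice \<alpha>" for z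
    by (simp_all add: L_def c_def quarter_lattice_def plane_lattice_cnj_iff plane_lattice_uminus_iff)
  have three: "j = 0 \<or> j = 1 \<or> j = 2" if "j < 3" for j :: nat using that by auto
  have Lfull: "L j \<subseteq> full_lattice \<alpha>" if "j < 3" for j
  proof
    fix z assume "z \<in> L j"
    then have "z \<in> quarter_lattice \<alpha> \<or> cnj z \<in> quarter_lattice \<alpha> \<or> - z \<in> quarter_lattice \<alpha>"
      using three[OF that] by (elim disjE) (simp_all only: L simp_thms)
    then have "z \<in> full_lattice \<alpha> \<or> cnj z \<in> full_lattice \<alpha> \<or> - z \<in> full_lattice \<alpha>"
      using quarter_subset_full by blast
    then show "z \<in> full_lattice \<alpha>"
      using full_cnj[of "cnj z"] full_uminus[of "- z"] by auto
  qed
  have Ldisj: "i = j" if "i < 3" "j < 3" "z \<in> L i" "z \<in> L j" for i j z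
  proof -
    have "\<not> (z \<in> L 0 \<and> z \<in> L 1)" "\<not> (z \<in> L 0 \<and> z \<in> L 2)" "\<not> (z \<in> L 1 \<and> z \<in> L 2)"
      using quarter_reflections_disjoint[OF \<alpha>(1), of z] quarter_reflections_disjoint[OF \<alpha>(1), of "cnj z"]
      unfolding L by auto
    then show ?thesis using three[OF that(1)] three[OF that(2)] that(3,4) by (elim disjE; simp)
  qed
  let ?U = "\<Union>j<3. perturb \<delta> j ` L j"
  have "has_uniform_density ?U (3 / ((2 * \<alpha>) * (2 * \<alpha>)))"
    unfolding L_def
  proof (rule perturbed_family_density[OF _ _ \<delta>(1,3)])
    show "plane_lattice (2 * \<alpha>) (2 * \<alpha>) (c j) \<subseteq> plane_lattice \<alpha> \<alpha> (lattice_center \<alpha>)" if "j < 3" for j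
      using Lfull[OF that] unfolding L_def full_lattice_def .
    show "Re z \<noteq> 0 \<and> Im z \<noteq> 0" if "z \<in> plane_lattice \<alpha> \<alpha> (lattice_center \<alpha>)" for z
      using full_nonzero[OF \<alpha>(1)] that unfolding full_lattice_def by blast
  qed (use \<alpha>(1) in simp_all)
  moreover have "3 / ((2 * \<alpha>) * (2 * \<alpha>)) = d"
  proof -
    have "(2 * \<alpha>) * (2 * \<alpha>) = 4 * (\<alpha> * \<alpha>)" by simp
    then show ?thesis using assms \<alpha>(2) by simp
  qed
  ultimately have "has_uniform_density ?U d" by simp
  moreover have "gabor_uniqueness_set ?U L2_real_even"
    unfolding gabor_uniqueness_set_def
  proof (intro ballI impI)
    fix g h assume gh: "g \<in> L2_real_even" "h \<in> L2_real_even"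
      and eq: "\<forall>u\<in>?U. cmod (gabor g (Re u) (Im u)) = cmod (gabor h (Re u) (Im u))"
    have real: "g \<in> L2_real" "h \<in> L2_real" using gh by (auto simp: L2_real_even_def)
    define E where "E = (\<lambda>j z. cmod (gabor g (Re (perturb \<delta> j z)) (Im (perturb \<delta> j z)))
      = cmod (gabor h (Re (perturb \<delta> j z)) (Im (perturb \<delta> j z))))"
    have Ecnj: "E j (cnj z) \<longleftrightarrow> E j z" for j z
      by (simp add: E_def perturb_cnj gabor_cnj[OF real(1)] gabor_cnj[OF real(2)])
    have Eneg: "E j (- z) \<longleftrightarrow> E j z" for j z
      by (simp add: E_def perturb_uminus gabor_reflect[OF gh(1)] gabor_reflect[OF gh(2)])
    have EL: "E j z" if "j < 3" "z \<in> L j" for j z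
    proof -
      have "perturb \<delta> j z \<in> ?U" using that by blast
      then show ?thesis using eq unfolding E_def by blast
    qed
    have quarter: "E j z" if "j < 3" "z \<in> quarter_lattice \<alpha>" for j z
    proof -
      have "z \<in> L 0" "cnj z \<in> L 1" "- z \<in> L 2" using that(2) L(1)[of z] L(2)[of "cnj z"] L(3)[of "- z"] by simp_all
      then have "E 0 z" "E 1 z" "E 2 z" using EL[of 0 z] EL[of 1 "cnj z"] EL[of 2 "- z"]
        by (simp_all add: Ecnj Eneg)
      then show ?thesis using three[OF that(1)] by blast
    qed
    have half: "E j z" if "j < 3" "z \<in> half_lattice \<alpha>" for j z
      using half_cases_quarter[OF that(2)] quarter[OF that(1), of z] quarter[OF that(1), of "- cnj z"]
        Ecnj[of j z] Eneg[of j "cnj z"] by blast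
    have all: "E j z" if "j < 3" "z \<in> full_lattice \<alpha>" for j z
      using full_cases_half[OF that(2)] half[OF that(1), of z] half[OF that(1), of "cnj z"]
        Ecnj[of j z] by blast
    show "\<exists>\<tau>. cmod \<tau> = 1 \<and> (AE t in lebesgue. g t = \<tau> * h t)"
    proof (rule gabor_phase_retrieval_perturbed_lattice[OF \<alpha>(1) _ \<delta>(1,2)])
      show "1 / (\<alpha> * \<alpha>) > 4" using assms by (simp add: \<alpha>(2) field_simps)
      show "g \<in> L2_complex" "h \<in> L2_complex" using real by (auto simp: L2_real_def)
      show "cmod (gabor g (Re (perturb \<delta> j z)) (Im (perturb \<delta> j z)))
          = cmod (gabor h (Re (perturb \<delta> j z)) (Im (perturb \<delta> j z)))"
        if "z \<in> full_lattice \<alpha>" "j < 3" for z j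
        using all[OF that(2,1)] by (simp only: E_def)
    qed
  qed
  moreover have "separated_set ?U"
  proof (rule separated_setI)
    show "\<alpha> / 2 > 0" using \<alpha> by simp
    fix u v assume "u \<in> ?U" "v \<in> ?U" "u \<noteq> v"
    then obtain i j z w where ij: "i < 3" "j < 3" and zw: "z \<in> L i" "w \<in> L j"
      and uv: "u = perturb \<delta> i z" "v = perturb \<delta> j w" by blast
    have "z \<noteq> w"
    proof
      assume "z = w"
      then have "i = j" using Ldisj[OF ij zw(1)] zw(2) by simp
      then show False using \<open>z = w\<close> uv \<open>u \<noteq> v\<close> by simp
    qed
    moreover have "z \<in> full_lattice \<alpha>" "w \<in> full_lattice \<alpha>" using Lfull ij zw by blast+
    ultimately have "\<alpha> \<le> cmod (z - w)"
      using plane_lattice_separated[OF \<alpha>(1)] unfolding full_lattice_def by blast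
    moreover have "cmod (z - w) \<le> cmod (u - v) + cmod ((u - z) - (v - w))"
      using norm_triangle_ineq4[of "u - v" "(u - z) - (v - w)"] by simp
    moreover have "cmod ((u - z) - (v - w)) \<le> \<delta> + \<delta>"
      using perturb_close[OF \<delta>(1), of i z] perturb_close[OF \<delta>(1), of j w]
        norm_triangle_ineq4[of "u - z" "v - w"] by (simp add: uv)
    ultimately show "\<alpha> / 2 \<le> cmod (u - v)" using \<delta>(3) by linarith
  qed
  ultimately show ?thesis by blast
qed

theorem theorem2p12:
  shows "(\<forall>d::real. d > 12 \<longrightarrow>
            (\<exists>U. uniformly_distributed U \<and> uniform_density U = d \<and>
                 gabor_uniqueness_set U L2_complex)) \<and>
         (\<forall>d::real. d > 6 \<longrightarrow>
            (\<exists>U. uniformly_distributed U \<and> uniform_density U = d \<and>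
                 gabor_uniqueness_set U L2_real)) \<and>
         (\<forall>d::real. d > 3 \<longrightarrow>
            (\<exists>U. uniformly_distributed U \<and> uniform_density U = d \<and>
                 gabor_uniqueness_set U L2_real_even \<and> separated_set U))"
proof (intro conjI allI impI)
  fix d :: real
  assume "d > 12"
  then have "\<exists>U. has_uniform_density U d \<and> gabor_uniqueness_set U L2_complex"
    by (rule exists_uniqueness_set_L2_complex)
  then obtain U where U: "has_uniform_density U d \<and> gabor_uniqueness_set U L2_complex"
    by (rule exE)
  show "\<exists>U. uniformly_distributed U \<and> uniform_density U = d \<and> gabor_uniqueness_set U L2_complex"
    using U uniform_density_eq[of U d] unfolding uniformly_distributed_def by (intro exI[of _ U]) metis
next
  fix d :: real
  assume "d > 6"
  then have "\<exists>U. has_uniform_density U d \<and> gabor_uniqueness_set U L2_real"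
    by (rule exists_uniqueness_set_L2_real)
  then obtain U where U: "has_uniform_density U d \<and> gabor_uniqueness_set U L2_real"
    by (rule exE)
  show "\<exists>U. uniformly_distributed U \<and> uniform_density U = d \<and> gabor_uniqueness_set U L2_real"
    using U uniform_density_eq[of U d] unfolding uniformly_distributed_def by (intro exI[of _ U]) metis
next
  fix d :: real
  assume "d > 3"
  then have "\<exists>U. has_uniform_density U d \<and> gabor_uniqueness_set U L2_real_even \<and> separated_set U"
    by (rule exists_separated_uniqueness_set_L2_real_even)
  then obtain U where U: "has_uniform_density U d \<and> gabor_uniqueness_set U L2_real_even \<and> separated_set U"
    by (rule exE)
  show "\<exists>U. uniformly_distributed U \<and> uniform_density U = d \<and>
      gabor_uniqueness_set U L2_real_even \<and> separated_set U"
    using U uniform_density_eq[of U d] unfolding uniformly_distributed_def by (intro exI[of _ U]) metis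
qed

end
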